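(* Let $(W,S)$ be a Coxeter system, $w\in W$, and $(I,J),(I',J')\in\mathrm{Asc}_L(w)\times\mathrm{Asc}_R(w)$ (pairs of subsets). Then $W_IwW_J=W_{I'}wW_{J'}$ if and only if $(I,J)$ can be obtained from $(I',J')$ by a finite sequence of plank moves.
   Context: $(W,S)$ is a Coxeter system with $S$ finite and Coxeter graph on $S$; connected components of subsets of $S$ are taken in this graph. $\mathrm{Asc}_L(w)=\{s:\ell(sw)>\ell(w)\}$, $\mathrm{Asc}_R(w)=\{s:\ell(ws)>\ell(w)\}$. A right ascent $s$ is small if $wsw^{-1}\in S$; a left ascent $t$ is small if $w^{-1}tw\in S$. Top-row adjacency: $s,t\in\mathrm{Asc}_R(w)$ are adjacent if they are adjacent in the Coxeter graph and at least one is a small right ascent; bottom-row adjacency: $s,t\in\mathrm{Asc}_L(w)$ are adjacent if adjacent in the Coxeter graph and at least one is a small left ascent. Plank moves on pairs $(I,J)\in\mathrm{Asc}_L(w)\times\mathrm{Asc}_R(w)$: let $I_0$ be a connected component of $I$ consisting entirely of small left ascents and $J_0=w^{-1}I_0w$. Contraction: $(I,J)\to(I\setminus I_0,J)$ if $J_0\subseteq J$. Expansion: the reverse, $(I\setminus I_0,J)\to(I,J)$ if $J_0\subseteq J$. Slide: $(I,J)\to(I\setminus I_0,J\cup J_0)$ if $J\cap J_0=\emptyset$ and $J_0$ is a connected component of $J\cup J_0$ with respect to top-row adjacency. The plank moves also include the analogous moves with the roles of $I$ and $J$ (left and right, $w$ and $w^{-1}$, top and bottom row) interchanged: for a connected component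 $J_0$ of $J$ consisting of small right ascents and $I_0=wJ_0w^{-1}$, $(I,J)\to(I,J\setminus J_0)$ if $I_0\subseteq I$, its reverse, and $(I,J)\to(I\cup I_0,J\setminus J_0)$ if $I\cap I_0=\emptyset$ and $I_0$ is a connected component of $I\cup I_0$ with respect to bottom-row adjacency. *)

theory Defs
  imports "HOL-Algebra.Generated_Groups" "HOL-Algebra.Multiplicative_Group"
begin

section \<open>Coxeter systems\<close>

definition word_prod :: "('a, 'b) monoid_scheme \<Rightarrow> 'a list \<Rightarrow> 'a" where
  "word_prod W xs = foldr (\<otimes>\<^bsub>W\<^esub>) xs \<one>\<^bsub>W\<^esub>"

text \<open>
  Deleting one Coxeter relator \<open>(s t)\<^bsup>m\<^esup>\<close> from a word over \<open>S\<close>, where \<open>m = m(s,t)\<close> is the order of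
  \<open>s t\<close>. If that order is infinite, \<open>group.ord\<close> is 0 and the relator is the empty word, so
  no relation is imposed.
\<close>

inductive relator_deletion :: "('a, 'b) monoid_scheme \<Rightarrow> 'a set \<Rightarrow> 'a list \<Rightarrow> 'a list \<Rightarrow> bool"
  for W :: "('a, 'b) monoid_scheme" and S :: "'a set" where
  "\<lbrakk>xs \<in> lists S; ys \<in> lists S; s \<in> S; t \<in> S\<rbrakk> \<Longrightarrow>
   relator_deletion W S
     (xs @ concat (replicate (group.ord W (s \<otimes>\<^bsub>W\<^esub> t)) [s, t]) @ ys) (xs @ ys)"

text \<open>
  The group \<open>W\<close> is generated by \<open>S\<close>, whose elements have order 2, and is presented by the
  relations \<open>(s t)\<^bsup>m(s,t)\<^esup> = 1\<close> for \<open>s\<close>, \<open>t\<close> in \<open>S\<close> with \<open>m(s,t)\<close> finite. The relators with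
  \<open>s = t\<close> are \<open>s s\<close>, so the monoid with this presentation is already the group with this
  presentation, and words without inverse letters suffice.
\<close>

locale coxeter_system = group W for W :: "('a, 'b) monoid_scheme" (structure) +
  fixes S :: "'a set"
  assumes S_subset: "S \<subseteq> carrier W"
    and S_generates: "generate W S = carrier W"
    and S_order: "s \<in> S \<Longrightarrow> ord s = 2"
    and presentation: "\<lbrakk>xs \<in> lists S; ys \<in> lists S; word_prod W xs = word_prod W ys\<rbrakk> \<Longrightarrow>
      equivclp (relator_deletion W S) xs ys"

definition coxeter_length :: "('a, 'b) monoid_scheme \<Rightarrow> 'a set \<Rightarrow> 'a \<Rightarrow> nat" where
  "coxeter_length W S w = (LEAST n. \<exists>xs \<in> lists S. length xs = n \<and> word_prod W xs = w)"

text \<open>Edges of the Coxeter graph: \<open>m(s,t)\<close> is at least 3 or infinite (encoded as 0).\<close>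

definition coxeter_graph :: "('a, 'b) monoid_scheme \<Rightarrow> 'a set \<Rightarrow> 'a rel" where
  "coxeter_graph W S =
     {(s, t). s \<in> S \<and> t \<in> S \<and> s \<noteq> t \<and> group.ord W (s \<otimes>\<^bsub>W\<^esub> t) \<noteq> 2}"

definition double_coset :: "('a, 'b) monoid_scheme \<Rightarrow> 'a set \<Rightarrow> 'a \<Rightarrow> 'a set \<Rightarrow> 'a set" where
  "double_coset W I w J = (generate W I #>\<^bsub>W\<^esub> w) <#>\<^bsub>W\<^esub> generate W J"

section \<open>Ascents\<close>

definition left_ascents :: "('a, 'b) monoid_scheme \<Rightarrow> 'a set \<Rightarrow> 'a \<Rightarrow> 'a set" where
  "left_ascents W S w =
     {s \<in> S. coxeter_length W S (s \<otimes>\<^bsub>W\<^esub> w) > coxeter_length W S w}"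

definition right_ascents :: "('a, 'b) monoid_scheme \<Rightarrow> 'a set \<Rightarrow> 'a \<Rightarrow> 'a set" where
  "right_ascents W S w =
     {s \<in> S. coxeter_length W S (w \<otimes>\<^bsub>W\<^esub> s) > coxeter_length W S w}"

definition small_left_ascents :: "('a, 'b) monoid_scheme \<Rightarrow> 'a set \<Rightarrow> 'a \<Rightarrow> 'a set" where
  "small_left_ascents W S w =
     {t \<in> left_ascents W S w. inv\<^bsub>W\<^esub> w \<otimes>\<^bsub>W\<^esub> t \<otimes>\<^bsub>W\<^esub> w \<in> S}"

definition small_right_ascents :: "('a, 'b) monoid_scheme \<Rightarrow> 'a set \<Rightarrow> 'a \<Rightarrow> 'a set" where
  "small_right_ascents W S w =
     {s \<in> right_ascents W S w. w \<otimes>\<^bsub>W\<^esub> s \<otimes>\<^bsub>W\<^esub> inv\<^bsub>W\<^esub> w \<in> S}"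

definition top_row_graph :: "('a, 'b) monoid_scheme \<Rightarrow> 'a set \<Rightarrow> 'a \<Rightarrow> 'a rel" where
  "top_row_graph W S w =
     {(s, t) \<in> coxeter_graph W S.
        s \<in> right_ascents W S w \<and> t \<in> right_ascents W S w \<and>
        (s \<in> small_right_ascents W S w \<or> t \<in> small_right_ascents W S w)}"

definition bottom_row_graph :: "('a, 'b) monoid_scheme \<Rightarrow> 'a set \<Rightarrow> 'a \<Rightarrow> 'a rel" where
  "bottom_row_graph W S w =
     {(s, t) \<in> coxeter_graph W S.
        s \<in> left_ascents W S w \<and> t \<in> left_ascents W S w \<and>
        (s \<in> small_left_ascents W S w \<or> t \<in> small_left_ascents W S w)}"

section \<open>Plank moves\<close>

text \<open>
  Vertex sets of the connected components of the subgraph induced on \<open>A\<close> by a symmetric relation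
  \<open>E\<close>. Components are nonempty.
\<close>

definition components :: "'a rel \<Rightarrow> 'a set \<Rightarrow> 'a set set" where
  "components E A = A // (Restr E A)\<^sup>*"

inductive plank_move ::
  "('a, 'b) monoid_scheme \<Rightarrow> 'a set \<Rightarrow> 'a \<Rightarrow> 'a set \<times> 'a set \<Rightarrow> 'a set \<times> 'a set \<Rightarrow> bool"
  for W :: "('a, 'b) monoid_scheme" and S :: "'a set" and w :: 'a where
  contract_left:
    "\<lbrakk>I \<subseteq> left_ascents W S w; J \<subseteq> right_ascents W S w;
      I0 \<in> components (coxeter_graph W S) I; I0 \<subseteq> small_left_ascents W S w;
      J0 = inv\<^bsub>W\<^esub> w <#\<^bsub>W\<^esub> I0 #>\<^bsub>W\<^esub> w; J0 \<subseteq> J\<rbrakk> \<Longrightarrow>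
     plank_move W S w (I, J) (I - I0, J)"
| expand_left:
    "\<lbrakk>I \<subseteq> left_ascents W S w; J \<subseteq> right_ascents W S w;
      I0 \<in> components (coxeter_graph W S) I; I0 \<subseteq> small_left_ascents W S w;
      J0 = inv\<^bsub>W\<^esub> w <#\<^bsub>W\<^esub> I0 #>\<^bsub>W\<^esub> w; J0 \<subseteq> J\<rbrakk> \<Longrightarrow>
     plank_move W S w (I - I0, J) (I, J)"
| slide_left:
    "\<lbrakk>I \<subseteq> left_ascents W S w; J \<subseteq> right_ascents W S w;
      I0 \<in> components (coxeter_graph W S) I; I0 \<subseteq> small_left_ascents W S w;
      J0 = inv\<^bsub>W\<^esub> w <#\<^bsub>W\<^esub> I0 #>\<^bsub>W\<^esub> w; J \<inter> J0 = {};
      J0 \<in> components (top_row_graph W S w) (J \<union> J0)\<rbrakk> \<Longrightarrow>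
     plank_move W S w (I, J) (I - I0, J \<union> J0)"
| contract_right:
    "\<lbrakk>I \<subseteq> left_ascents W S w; J \<subseteq> right_ascents W S w;
      J0 \<in> components (coxeter_graph W S) J; J0 \<subseteq> small_right_ascents W S w;
      I0 = w <#\<^bsub>W\<^esub> J0 #>\<^bsub>W\<^esub> inv\<^bsub>W\<^esub> w; I0 \<subseteq> I\<rbrakk> \<Longrightarrow>
     plank_move W S w (I, J) (I, J - J0)"
| expand_right:
    "\<lbrakk>I \<subseteq> left_ascents W S w; J \<subseteq> right_ascents W S w;
      J0 \<in> components (coxeter_graph W S) J; J0 \<subseteq> small_right_ascents W S w;
      I0 = w <#\<^bsub>W\<^esub> J0 #>\<^bsub>W\<^esub> inv\<^bsub>W\<^esub> w; I0 \<subseteq> I\<rbrakk> \<Longrightarrow>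
     plank_move W S w (I, J - J0) (I, J)"
| slide_right:
    "\<lbrakk>I \<subseteq> left_ascents W S w; J \<subseteq> right_ascents W S w;
      J0 \<in> components (coxeter_graph W S) J; J0 \<subseteq> small_right_ascents W S w;
      I0 = w <#\<^bsub>W\<^esub> J0 #>\<^bsub>W\<^esub> inv\<^bsub>W\<^esub> w; I \<inter> I0 = {};
      I0 \<in> components (bottom_row_graph W S w) (I \<union> I0)\<rbrakk> \<Longrightarrow>
     plank_move W S w (I, J) (I \<union> I0, J - J0)"

end

(* A double coset C = W_I w W_J is stable under W_(I Un I') on the left and W_(J Un J') on the
   right as soon as also C = W_I' w W_J', so it suffices to connect (I, J) with
   (I Un I', J Un J') by contractions and expansions, first enlarging I and then J. Let I <= I' with
   W_I' w <= W_I w W_J and put D = {s : I'. w^-1 s w : J}. By Kilmoyer's theorem W_I' = W_I W_D.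
   Let s_0, ..., s_k be a path in the graph on I' with s_0 not in I. The product s_0 ... s_k has s_0
   as its only left descent, so it lies in W_I W_D only if all s_i lie in D. Hence every component
   of I' not contained in I lies in D, and can be contracted away from both (I', J) and (I, J).
   The exchange condition is derived from the presentation: the parity with which a reflection
   occurs among those attached to a word is invariant under deletion of relators. *)

theory Submission
  imports Defs "HOL-Library.Sublist"
begin

text \<open>The equality W_I' = W_I W_D, tested on single generators, only shows that I' - I lies in
  D; it says nothing about a neighbour in I of such a generator, since that neighbour already lies
  in W_I. A contraction needs a whole component inside D, so the test element has to spell out a
  path that starts outside I, and its unique left descent prevents any part of it from being
  absorbed by W_I.

  Conversely, every plank move preserves the double coset. A contracted component commutes with the
  rest of its row and passes through w into the subgroup of the other row. A slide from (I, J) is an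
  expansion to (I, J \<union> J0) followed by the contraction that removes I0.

  Inversion exchanges W_I w W_J with W_J w^-1 W_I and the left moves for w with the right moves for
  w^-1, so the main arguments are given on the left only.\<close>

context coxeter_system
begin

section \<open>Words over \<open>S\<close> and the subgroups generated by subsets of
  \<open>S\<close>\<close>

abbreviation len :: "'a \<Rightarrow> nat" where "len \<equiv> coxeter_length W S"
abbreviation wprod :: "'a list \<Rightarrow> 'a" where "wprod \<equiv> word_prod W"

lemma gen_closed [simp]: "s \<in> S \<Longrightarrow> s \<in> carrier W"
  using S_subset by blast

lemma word_prod_Nil [simp]: "wprod [] = \<one>"
  and word_prod_Cons [simp]: "wprod (x # xs) = x \<otimes> wprod xs"
  by (simp_all add: word_prod_def)

lemma word_prod_closed [simp]: "set xs \<subseteq> carrier W \<Longrightarrow> wprod xs \<in> carrier W"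
  by (induction xs) auto

lemma set_subset_carrier [simp]: "set xs \<subseteq> S \<Longrightarrow> set xs \<subseteq> carrier W"
  using S_subset by blast

lemma word_prod_append:
  "set xs \<subseteq> carrier W \<Longrightarrow> set ys \<subseteq> carrier W \<Longrightarrow> wprod (xs @ ys) = wprod xs \<otimes> wprod ys"
  by (induction xs) (auto simp: m_assoc)

lemma gen_square: "s \<in> S \<Longrightarrow> s \<otimes> s = \<one>"
  using pow_ord_eq_1[of s] S_order[of s] by (simp add: numeral_2_eq_2)

lemma gen_inv [simp]: "s \<in> S \<Longrightarrow> inv s = s"
  using gen_square inv_unique'[of s s] by simp

lemma gen_ne_one: "s \<in> S \<Longrightarrow> s \<noteq> \<one>"
  using S_order[of s] by auto

lemma gen_cancel [simp]: "s \<in> S \<Longrightarrow> x \<in> carrier W \<Longrightarrow> s \<otimes> (s \<otimes> x) = x"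
  using gen_square[of s] m_assoc[of s s x] by simp

lemma inv_cancel [simp]:
  assumes "x \<in> carrier W" "y \<in> carrier W"
  shows "x \<otimes> (inv x \<otimes> y) = y" "inv x \<otimes> (x \<otimes> y) = y"
  using assms by (simp_all flip: m_assoc)

lemma generate_eq_words:
  assumes "K \<subseteq> S"
  shows "generate W K = {wprod xs |xs. set xs \<subseteq> K}"
proof
  show "generate W K \<subseteq> {wprod xs |xs. set xs \<subseteq> K}"
  proof
    fix x assume "x \<in> generate W K"
    then have "\<exists>xs. x = wprod xs \<and> set xs \<subseteq> K"
    proof (induction rule: generate.induct)
      case one
      then show ?case by (auto intro!: exI[of _ "[]"])
    next
      case (incl h)
      then show ?case using assms by (auto intro!: exI[of _ "[h]"])
    next
      case (inv h)
      then have "inv h = h" using assms by auto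
      with inv show ?case using assms by (auto intro!: exI[of _ "[h]"])
    next
      case (eng h1 h2)
      then obtain xs ys where h: "set xs \<subseteq> K" "set ys \<subseteq> K" "h1 = wprod xs" "h2 = wprod ys"
        by blast
      then have "set xs \<subseteq> S" "set ys \<subseteq> S" using assms by auto
      then have "h1 \<otimes> h2 = wprod (xs @ ys)" using h word_prod_append[of xs ys] by simp
      then show ?case using h by (intro exI[of _ "xs @ ys"]) simp
    qed
    then show "x \<in> {wprod xs |xs. set xs \<subseteq> K}" by blast
  qed
next
  have "wprod xs \<in> generate W K" if "set xs \<subseteq> K" for xs
    using that by (induction xs) (auto intro: generate.intros)
  then show "{wprod xs |xs. set xs \<subseteq> K} \<subseteq> generate W K" by blast
qed

lemma carrier_word:
  assumes "x \<in> carrier W"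
  obtains xs where "set xs \<subseteq> S" "wprod xs = x"
proof -
  have "x \<in> {wprod xs |xs. set xs \<subseteq> S}"
    using assms S_generates generate_eq_words[OF order_refl] by simp
  then show thesis using that by blast
qed

subsection \<open>The exchange condition\<close>

text \<open>The parity of the number of occurrences of \<open>r\<close> among the reflections
  \<open>s\<^sub>1 \<dots> s\<^sub>i\<^sub>-\<^sub>1 s\<^sub>i s\<^sub>i\<^sub>-\<^sub>1 \<dots> s\<^sub>1\<close> attached to the word.\<close>

primrec inverted :: "'a list \<Rightarrow> 'a \<Rightarrow> bool" where
  "inverted [] r = False"
| "inverted (s # xs) r = ((r = s) \<noteq> inverted xs (s \<otimes> r \<otimes> s))"

lemma inverted_append:
  "set xs \<subseteq> S \<Longrightarrow> r \<in> carrier W \<Longrightarrow>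
   inverted (xs @ ys) r = (inverted xs r \<noteq> inverted ys (inv (wprod xs) \<otimes> r \<otimes> wprod xs))"
  by (induction xs arbitrary: r) (auto simp: inv_mult_group m_assoc)

text \<open>The reflections attached to the word s t s t ... are (s t)^i s, one for each position i;
  the sum counts those equal to \<open>r\<close>.\<close>

lemma inverted_alternating:
  assumes st: "s \<in> S" "t \<in> S" and "r \<in> carrier W"
  shows "inverted (concat (replicate k [s, t])) r \<longleftrightarrow>
    odd (\<Sum>i<2*k. of_bool ((s \<otimes> t) [^] i \<otimes> s = r) :: nat)"
  using assms(3)
proof (induction k arbitrary: r)
  case 0
  then show ?case by simp
next
  case (Suc k)
  define c where "c = s \<otimes> t"
  have c: "c \<in> carrier W" using st by (simp add: c_def)
  have e1: "s \<otimes> r \<otimes> s = t \<longleftrightarrow> c [^] Suc 0 \<otimes> s = r"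
    using st Suc.prems by (auto simp: c_def m_assoc gen_square)
  \<comment> \<open>Two letters are peeled off at once. This replaces \<open>r\<close> by its
    conjugate under c = s t, and since s c^-1 = c s, conjugating c^i s by c raises the exponent by
    exactly two.\<close>
  have e2: "c [^] i \<otimes> s = t \<otimes> (s \<otimes> r \<otimes> s) \<otimes> t \<longleftrightarrow> c [^] Suc (Suc i) \<otimes> s = r" for i
  proof -
    have ci: "c [^] i \<in> carrier W" using c by simp
    have "c [^] Suc (Suc i) \<otimes> s = c \<otimes> (c [^] i \<otimes> s) \<otimes> inv c"
    proof -
      have "s \<otimes> inv c = c \<otimes> s" using st by (simp add: c_def inv_mult_group m_assoc)
      moreover have "c [^] Suc (Suc i) = c \<otimes> c [^] i \<otimes> c"
        using c nat_pow_comm[of c "Suc 0" i] by simp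
      ultimately show ?thesis using c st ci by (simp add: m_assoc)
    qed
    moreover have "c \<otimes> (t \<otimes> (s \<otimes> r \<otimes> s) \<otimes> t) \<otimes> inv c = r"
      using st Suc.prems by (simp add: c_def inv_mult_group m_assoc gen_square)
    moreover have "c \<otimes> x \<otimes> inv c = c \<otimes> y \<otimes> inv c \<longleftrightarrow> x = y"
      if "x \<in> carrier W" "y \<in> carrier W" for x y
      using that c by simp
    ultimately show ?thesis
      using st Suc.prems ci by (metis m_closed gen_closed)
  qed
  have "2 * Suc k = Suc (Suc (2 * k))" by simp
  then have "(\<Sum>i<2*Suc k. of_bool (c [^] i \<otimes> s = r) :: nat) =
    of_bool (c [^] (0::nat) \<otimes> s = r) + (of_bool (c [^] Suc 0 \<otimes> s = r) +
      (\<Sum>i<2*k. of_bool (c [^] Suc (Suc i) \<otimes> s = r)))"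
    by (simp only: sum.lessThan_Suc_shift)
  also have "odd \<dots> \<longleftrightarrow> inverted (concat (replicate (Suc k) [s, t])) r"
  proof -
    have "inverted (concat (replicate (Suc k) [s, t])) r \<longleftrightarrow>
      (r = s) \<noteq> ((s \<otimes> r \<otimes> s = t) \<noteq>
        odd (\<Sum>i<2*k. of_bool (c [^] i \<otimes> s = t \<otimes> (s \<otimes> r \<otimes> s) \<otimes> t) :: nat))"
      using st Suc.prems Suc.IH[of "t \<otimes> (s \<otimes> r \<otimes> s) \<otimes> t"] by (simp add: c_def)
    moreover have "c [^] (0::nat) \<otimes> s = r \<longleftrightarrow> r = s" using st by auto
    ultimately show ?thesis
      unfolding e1 e2 by (simp only: odd_add odd_of_bool_self)
  qed
  finally show ?case unfolding c_def by simp
qed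

text \<open>The reflections (s t)^i s are periodic in i with period m, and a relator has 2m letters,
  so each reflection is counted an even number of times. For infinite order m = 0 and the word is
  empty.\<close>

lemma inverted_relator:
  assumes st: "s \<in> S" "t \<in> S" and "r \<in> carrier W"
  shows "\<not> inverted (concat (replicate (ord (s \<otimes> t)) [s, t])) r"
proof -
  define m where "m = ord (s \<otimes> t)"
  define f :: "nat \<Rightarrow> nat" where "f i = of_bool ((s \<otimes> t) [^] i \<otimes> s = r)" for i
  have c: "s \<otimes> t \<in> carrier W" using st by simp
  have "(s \<otimes> t) [^] (m + i) = (s \<otimes> t) [^] i" for i
    using c pow_ord_eq_1[OF c] by (simp add: m_def flip: nat_pow_mult)
  then have per: "f (m + i) = f i" for i by (simp add: f_def)
  have "(\<Sum>i<n + k. f i) = (\<Sum>i<n. f i) + (\<Sum>i<k. f (n + i))" for n k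
    by (induction k) auto
  from this[of m m] have "(\<Sum>i<2*m. f i) = 2 * (\<Sum>i<m. f i)"
    by (simp add: per mult_2)
  then show ?thesis using inverted_alternating[OF assms, of m]
    unfolding m_def[symmetric] f_def by simp
qed

lemma word_prod_alternating:
  assumes "s \<in> S" "t \<in> S"
  shows "wprod (concat (replicate k [s, t])) = (s \<otimes> t) [^] k"
  using assms
proof (induction k)
  case (Suc k)
  then have "wprod (concat (replicate (Suc k) [s, t])) = (s \<otimes> t) \<otimes> (s \<otimes> t) [^] k"
    by (simp add: m_assoc)
  then show ?case using Suc.prems nat_pow_Suc2[of "s \<otimes> t" k] by simp
qed simp

text \<open>A relator has product one, so the reflections of the letters after it do not change when
  it is deleted, and its own reflections cancel in parity. The presentation links any two words for
  the same element by such deletions and their reverses, so \<open>inverted\<close> depends on the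
  group element only.\<close>

lemma inverted_cong:
  assumes "set xs \<subseteq> S" "set ys \<subseteq> S" "wprod xs = wprod ys" "r \<in> carrier W"
  shows "inverted xs r = inverted ys r"
proof -
  have step: "inverted us r = inverted vs r" if "relator_deletion W S us vs" for us vs
    using that
  proof cases
    case (1 xs ys s t)
    let ?R = "concat (replicate (ord (s \<otimes> t)) [s, t])"
    have sR: "set ?R \<subseteq> S" using 1 by auto
    have [simp]: "wprod ?R = \<one>" using 1 word_prod_alternating by simp
    have sx: "set xs \<subseteq> S" using 1 by auto
    have [simp]: "wprod xs \<in> carrier W" using sx by simp
    show ?thesis unfolding 1(1,2)
      using sR sx assms(4) 1(5,6) inverted_relator
      by (simp add: inverted_append)
  qed
  have "equivclp (relator_deletion W S) xs ys"
    by (rule presentation) (use assms in auto)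
  then show ?thesis
    by (induction rule: equivclp_induct) (use step in blast)+
qed

text \<open>Odd parity means that \<open>r\<close> is the reflection p b p^-1 of some letter b after
  a prefix p, and multiplying by it on the left erases that letter.\<close>

lemma delete_letter:
  assumes "set xs \<subseteq> S" "r \<in> carrier W" "inverted xs r"
  shows "\<exists>as b bs. xs = as @ b # bs \<and> r \<otimes> wprod xs = wprod (as @ bs)"
  using assms
proof (induction xs arbitrary: r)
  case Nil
  then show ?case by simp
next
  case (Cons s xs)
  show ?case
  proof (cases "r = s")
    case True
    then have "s # xs = [] @ s # xs \<and> r \<otimes> wprod (s # xs) = wprod ([] @ xs)"
      using Cons.prems by simp
    then show ?thesis by blast
  next
    case False
    then obtain as b bs where xs: "xs = as @ b # bs"
      and eq: "(s \<otimes> r \<otimes> s) \<otimes> wprod xs = wprod (as @ bs)"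
      using Cons.prems Cons.IH[of "s \<otimes> r \<otimes> s"] by auto
    have [simp]: "wprod xs \<in> carrier W" "s \<in> S" using Cons.prems by auto
    have "s \<otimes> wprod (as @ bs) = r \<otimes> (s \<otimes> wprod xs)"
      using Cons.prems(2) by (simp add: m_assoc flip: eq)
    then have "s # xs = (s # as) @ b # bs \<and> r \<otimes> wprod (s # xs) = wprod ((s # as) @ bs)"
      using xs by simp
    then show ?thesis by blast
  qed
qed

section \<open>Reduced words, exchange and deletion\<close>

definition reduced :: "'a list \<Rightarrow> bool" where
  "reduced xs \<longleftrightarrow> set xs \<subseteq> S \<and> length xs = len (wprod xs)"

lemma len_le: "set xs \<subseteq> S \<Longrightarrow> len (wprod xs) \<le> length xs"
  unfolding coxeter_length_def by (rule Least_le) auto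

lemma ex_reduced:
  assumes "x \<in> carrier W"
  obtains xs where "reduced xs" "wprod xs = x"
proof -
  have "\<exists>n. \<exists>xs\<in>lists S. length xs = n \<and> wprod xs = x"
    using carrier_word[OF assms] by (metis in_lists_conv_set subsetD)
  from LeastI_ex[OF this] obtain xs where
    "xs \<in> lists S" "length xs = len x" "wprod xs = x"
    unfolding coxeter_length_def by blast
  then show thesis using that[of xs] unfolding reduced_def by auto
qed

lemma reducedD: "reduced xs \<Longrightarrow> set xs \<subseteq> S"
  by (simp add: reduced_def)

text \<open>Parity is the same for all words of the element, so it may be read off a reduced word,
  where erasing a letter really shortens.\<close>

lemma len_less_if_inverted:
  assumes "s \<in> S" "set xs \<subseteq> S" "inverted xs s"
  shows "len (s \<otimes> wprod xs) < len (wprod xs)"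
proof -
  have "wprod xs \<in> carrier W" using assms by simp
  then obtain ys where ys: "reduced ys" "wprod ys = wprod xs" by (rule ex_reduced)
  then have "inverted ys s"
    using assms inverted_cong[of ys xs s] by (auto dest: reducedD)
  then obtain as b bs where d: "ys = as @ b # bs" "s \<otimes> wprod ys = wprod (as @ bs)"
    using delete_letter[of ys s] reducedD[OF ys(1)] assms(1) gen_closed by blast
  have "len (wprod (as @ bs)) \<le> length (as @ bs)"
    using reducedD[OF ys(1)] d by (intro len_le) auto
  also have "\<dots> < length ys" using d by simp
  finally show ?thesis using ys d unfolding reduced_def by simp
qed

lemma inverted_iff:
  assumes "s \<in> S" "set xs \<subseteq> S"
  shows "inverted xs s \<longleftrightarrow> len (s \<otimes> wprod xs) < len (wprod xs)"
    and "\<not> inverted xs s \<longleftrightarrow> len (wprod xs) < len (s \<otimes> wprod xs)"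
proof -
  have "len (wprod xs) < len (s \<otimes> wprod xs)" if "\<not> inverted xs s"
  proof -
    \<comment> \<open>Prepending \<open>s\<close> flips the parity at \<open>s\<close>, so one of
      the two elements is always shortened by \<open>s\<close>; equality of lengths cannot
      occur.\<close>
    have "s \<otimes> s \<otimes> s = s" using assms gen_square by simp
    then have "inverted (s # xs) s" using that by simp
    then show ?thesis using len_less_if_inverted[of s "s # xs"] assms by simp
  qed
  then show "inverted xs s \<longleftrightarrow> len (s \<otimes> wprod xs) < len (wprod xs)"
    "\<not> inverted xs s \<longleftrightarrow> len (wprod xs) < len (s \<otimes> wprod xs)"
    using len_less_if_inverted[OF assms] by fastforce+
qed

lemma exchange:
  assumes "s \<in> S" "set xs \<subseteq> S" "len (s \<otimes> wprod xs) \<le> len (wprod xs)"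
  shows "\<exists>as b bs. xs = as @ b # bs \<and> s \<otimes> wprod xs = wprod (as @ bs)"
proof -
  have "inverted xs s" using inverted_iff(2)[OF assms(1,2)] assms(3) by auto
  then show ?thesis using delete_letter[of xs s] assms by simp
qed

lemma len_gen_mult:
  assumes "s \<in> S" "x \<in> carrier W"
  shows "len (s \<otimes> x) \<noteq> len x" "len (s \<otimes> x) \<le> Suc (len x)"
proof -
  obtain xs where xs: "reduced xs" "wprod xs = x" using assms ex_reduced by blast
  then have "set xs \<subseteq> S" by (simp add: reducedD)
  then show "len (s \<otimes> x) \<noteq> len x" using inverted_iff[of s xs] assms xs by fastforce
  have "len (wprod (s # xs)) \<le> length (s # xs)"
    using \<open>set xs \<subseteq> S\<close> assms by (intro len_le) simp
  then show "len (s \<otimes> x) \<le> Suc (len x)"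
    using xs by (simp add: reduced_def)
qed

lemma reduced_Nil [simp]: "reduced []"
  using len_le[of "[]"] by (simp add: reduced_def)

lemma reduced_Cons_iff:
  assumes "reduced xs" "s \<in> S"
  shows "reduced (s # xs) \<longleftrightarrow> len (wprod xs) < len (s \<otimes> wprod xs)"
  using assms len_gen_mult[of s "wprod xs"] len_le[of "s # xs"]
  unfolding reduced_def by auto

lemma reduced_ConsD:
  assumes "reduced (s # xs)"
  shows "reduced xs" "s \<in> S" "len (wprod xs) < len (s \<otimes> wprod xs)"
proof -
  have s: "s \<in> S" "set xs \<subseteq> S" using assms by (auto simp: reduced_def)
  then show "reduced xs"
    using assms len_gen_mult(2)[of s "wprod xs"] len_le[of xs] by (auto simp: reduced_def)
  then show "s \<in> S" "len (wprod xs) < len (s \<otimes> wprod xs)"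
    using assms s reduced_Cons_iff by auto
qed

lemma nonreduced_split:
  assumes "set xs \<subseteq> S" "\<not> reduced xs"
  shows "\<exists>as s bs. xs = as @ s # bs \<and> reduced bs \<and> \<not> reduced (s # bs)"
  using assms
proof (induction xs)
  case (Cons s xs)
  show ?case
  proof (cases "reduced xs")
    case True
    then show ?thesis using Cons.prems by blast
  next
    case False
    then obtain as t bs where "xs = as @ t # bs" "reduced bs" "\<not> reduced (t # bs)"
      using Cons by auto
    then have "s # xs = (s # as) @ t # bs" by simp
    then show ?thesis using \<open>reduced bs\<close> \<open>\<not> reduced (t # bs)\<close> by blast
  qed
qed simp

text \<open>A reduced suffix that stops being reduced when \<open>s\<close> is put in front has
  \<open>s\<close> as a left descent, so exchange erases a second letter along with
  \<open>s\<close>.\<close>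

lemma deletion:
  assumes "set xs \<subseteq> S" "\<not> reduced xs"
  shows "\<exists>as s bs t cs. xs = as @ s # bs @ t # cs \<and> reduced (bs @ t # cs) \<and>
    \<not> reduced (s # bs @ t # cs) \<and> s \<otimes> wprod (bs @ t # cs) = wprod (bs @ cs)"
proof -
  obtain as s ds where d: "xs = as @ s # ds" "reduced ds" "\<not> reduced (s # ds)"
    using nonreduced_split[OF assms] by blast
  have s: "s \<in> S" "set ds \<subseteq> S" using assms d by auto
  then have "len (s \<otimes> wprod ds) \<le> len (wprod ds)" using d reduced_Cons_iff by auto
  then obtain bs t cs where "ds = bs @ t # cs" "s \<otimes> wprod ds = wprod (bs @ cs)"
    using exchange[OF s] by blast
  then show ?thesis using d by blast
qed

lemma reduced_subword:
  assumes "set xs \<subseteq> S"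
  shows "\<exists>ys. reduced ys \<and> subseq ys xs \<and> wprod ys = wprod xs"
  using assms
proof (induction xs rule: length_induct)
  case (1 xs)
  show ?case
  proof (cases "reduced xs")
    case True
    then show ?thesis by blast
  next
    case False
    obtain as s bs t cs where d: "xs = as @ s # bs @ t # cs"
        "s \<otimes> wprod (bs @ t # cs) = wprod (bs @ cs)"
      using deletion 1 False by blast
    have sub: "set xs \<subseteq> carrier W" using 1 by simp
    have eq: "wprod (as @ bs @ cs) = wprod xs"
      using sub d word_prod_append[of as "s # bs @ t # cs"] word_prod_append[of as "bs @ cs"]
      by simp
    have "subseq (as @ bs @ cs) xs"
      unfolding d by (intro list_emb_append_mono list_emb_Cons subseq_order.refl)
    moreover have "set (as @ bs @ cs) \<subseteq> S" using 1 d by auto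
    moreover have "length (as @ bs @ cs) < length xs" using d by simp
    ultimately obtain ys where "reduced ys" "subseq ys (as @ bs @ cs)" "wprod ys = wprod xs"
      using 1(1) eq by metis
    then show ?thesis using \<open>subseq (as @ bs @ cs) xs\<close> subseq_order.trans by blast
  qed
qed

lemma set_subseq: "subseq ys xs \<Longrightarrow> set ys \<subseteq> set xs"
  by (auto elim: list_emb_set)

text \<open>Deletion only discards letters, so a reduced word for an element of the subgroup can be
  found inside \<open>K\<close>. This lets the length with respect to all of \<open>S\<close> be
  used within W_K.\<close>

lemma generate_reduced:
  assumes "K \<subseteq> S" "x \<in> generate W K"
  obtains xs where "reduced xs" "set xs \<subseteq> K" "wprod xs = x"
proof -
  obtain xs0 where "set xs0 \<subseteq> K" "wprod xs0 = x"
    using assms by (auto simp: generate_eq_words)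
  then show thesis
    using reduced_subword[of xs0] set_subseq assms that by (metis subset_trans)
qed

lemma generate_closed [simp]: "K \<subseteq> S \<Longrightarrow> x \<in> generate W K \<Longrightarrow> x \<in> carrier W"
  using generate_in_carrier[of K x] S_subset by blast

lemma word_prod_in_generate: "K \<subseteq> S \<Longrightarrow> set xs \<subseteq> K \<Longrightarrow> wprod xs \<in> generate W K"
  by (auto simp: generate_eq_words)

lemma generate_mono: "A \<subseteq> B \<Longrightarrow> x \<in> generate W A \<Longrightarrow> x \<in> generate W B"
  using mono_generate by blast

lemma len_one_gen:
  assumes "x \<in> generate W K" "K \<subseteq> S" "len x \<le> 1" "x \<noteq> \<one>"
  shows "x \<in> K"
proof -
  obtain xs where xs: "reduced xs" "set xs \<subseteq> K" "wprod xs = x"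
    using generate_reduced assms by blast
  then have "length xs \<le> 1" using assms by (simp add: reduced_def)
  then show ?thesis using xs assms by (cases xs) auto
qed

lemma gen_in_generate:
  assumes "s \<in> S" "K \<subseteq> S" "s \<in> generate W K"
  shows "s \<in> K"
  using len_one_gen[of s K] len_le[of "[s]"] assms gen_ne_one by simp

lemma word_prod_rev: "set xs \<subseteq> S \<Longrightarrow> wprod (rev xs) = inv (wprod xs)"
proof (induction xs)
  case (Cons s xs)
  then have "set (rev xs) \<subseteq> S" by simp
  then show ?case using Cons by (simp add: word_prod_append inv_mult_group)
qed simp

lemma len_inv:
  assumes "x \<in> carrier W"
  shows "len (inv x) = len x"
proof -
  have le: "len (inv y) \<le> len y" if y: "y \<in> carrier W" for y
  proof -
    obtain xs where xs: "reduced xs" "wprod xs = y" using ex_reduced[OF y] by blast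
    then have "set xs \<subseteq> S" by (simp add: reducedD)
    then show ?thesis using len_le[of "rev xs"] xs
      by (simp add: word_prod_rev reduced_def)
  qed
  show ?thesis using le[of x] le[of "inv x"] assms by simp
qed

lemma generate_inv [simp]: "K \<subseteq> S \<Longrightarrow> x \<in> generate W K \<Longrightarrow> inv x \<in> generate W K"
  using generate_m_inv_closed[of K x] S_subset by blast

lemma left_ascents_subset: "left_ascents W S x \<subseteq> S"
  and right_ascents_subset: "right_ascents W S x \<subseteq> S"
  by (auto simp: left_ascents_def right_ascents_def)

lemma ascents_inv:
  assumes "x \<in> carrier W"
  shows "left_ascents W S (inv x) = right_ascents W S x"
    and "right_ascents W S (inv x) = left_ascents W S x"
proof -
  have "len (s \<otimes> inv x) = len (x \<otimes> s)" "len (inv x \<otimes> s) = len (s \<otimes> x)" if "s \<in> S" for s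
    using that assms len_inv[of "x \<otimes> s"] len_inv[of "s \<otimes> x"] by (simp_all add: inv_mult_group)
  then show "left_ascents W S (inv x) = right_ascents W S x"
    "right_ascents W S (inv x) = left_ascents W S x"
    using assms by (auto simp: left_ascents_def right_ascents_def len_inv)
qed

subsection \<open>Minimal elements of cosets\<close>

text \<open>If prepending \<open>s\<close> to the reduced word \<open>vs @ ws\<close> failed,
  exchange would erase a letter. In \<open>vs\<close> this contradicts that \<open>s # vs\<close> is
  reduced; in \<open>ws\<close> it gives a shorter word for v^-1 s v times the product of
  \<open>ws\<close>, which lies in the same coset of W_K, against minimality.\<close>

lemma reduced_append_minimal:
  assumes K: "K \<subseteq> S" and "\<And>x. x \<in> generate W K \<Longrightarrow> len (wprod ws) \<le> len (x \<otimes> wprod ws)"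
    and ws: "reduced ws" and "reduced vs" "set vs \<subseteq> K"
  shows "reduced (vs @ ws)"
  using assms(4,5)
proof (induction vs)
  case Nil
  then show ?case using ws by simp
next
  case (Cons s vs)
  note red = reduced_ConsD[OF Cons.prems(1)]
  have IH: "reduced (vs @ ws)" using Cons red by simp
  have in_S: "set vs \<subseteq> S" "set ws \<subseteq> S" using red ws by (auto dest: reducedD)
  show ?case
  proof (rule ccontr)
    assume "\<not> reduced ((s # vs) @ ws)"
    then have "len (s \<otimes> wprod (vs @ ws)) \<le> len (wprod (vs @ ws))"
      using reduced_Cons_iff[OF IH red(2)] by simp
    then obtain as b bs where d: "vs @ ws = as @ b # bs"
        and eq: "s \<otimes> wprod (vs @ ws) = wprod (as @ bs)"
      using exchange[of s "vs @ ws"] in_S red(2) by auto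
    from d consider us where "vs = as @ b # us" "bs = us @ ws"
      | us where "as = vs @ us" "ws = us @ b # bs"
      by (auto simp: append_eq_append_conv2 append_eq_Cons_conv)
    then show False
    proof cases
      case 1
      then have us: "set (as @ us) \<subseteq> S" using in_S by auto
      then have "(s \<otimes> wprod vs) \<otimes> wprod ws = wprod (as @ us) \<otimes> wprod ws"
        using eq in_S red(2) word_prod_append[of "as @ us" ws]
        by (simp add: word_prod_append 1(2) m_assoc)
      then have "s \<otimes> wprod vs = wprod (as @ us)"
        using us in_S red(2) by simp
      then have "len (s \<otimes> wprod vs) \<le> length (as @ us)" using len_le us by metis
      then show False using red(3) 1(1) red(1) by (simp add: reduced_def)
    next
      case 2
      then have us: "set (us @ bs) \<subseteq> S" using in_S by auto
      then have "wprod vs \<otimes> wprod (us @ bs) = s \<otimes> (wprod vs \<otimes> wprod ws)"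
        using eq in_S word_prod_append[of vs "us @ bs"] by (simp add: word_prod_append 2(1))
      then have "wprod (us @ bs) = inv (wprod vs) \<otimes> (s \<otimes> (wprod vs \<otimes> wprod ws))"
        using us in_S red(2) inv_solve_left[of "wprod (us @ bs)" "wprod vs"] by simp
      also have "\<dots> = (inv (wprod vs) \<otimes> s \<otimes> wprod vs) \<otimes> wprod ws"
        using in_S red(2) by (simp add: m_assoc)
      finally have "wprod (us @ bs) = (inv (wprod vs) \<otimes> s \<otimes> wprod vs) \<otimes> wprod ws" .
      moreover have "inv (wprod vs) \<otimes> s \<otimes> wprod vs \<in> generate W K"
        using K Cons.prems by (intro generate.eng generate_inv generate.incl word_prod_in_generate) auto
      ultimately have "len (wprod ws) \<le> len (wprod (us @ bs))" using assms(2) by metis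
      also have "\<dots> \<le> length (us @ bs)" using us by (rule len_le)
      finally show False using ws 2(2) by (simp add: reduced_def)
    qed
  qed
qed

text \<open>Local minimality implies global minimality. With x0 w shortest in W_K w, the
  factorization w = x0^-1 (x0 w) adds lengths; if x0 were not one, the first letter of a reduced
  word of x0^-1 would be a left descent of w in \<open>K\<close>.\<close>

lemma left_ascents_minimal:
  assumes w: "w \<in> carrier W" and K: "K \<subseteq> left_ascents W S w" and x: "x \<in> generate W K"
  shows "len w \<le> len (x \<otimes> w)"
proof -
  have KS: "K \<subseteq> S" using K left_ascents_subset by blast
  obtain x0 where x0: "x0 \<in> generate W K"
    and min: "\<And>y. y \<in> generate W K \<Longrightarrow> len (x0 \<otimes> w) \<le> len (y \<otimes> w)"
    using ex_has_least_nat[of "\<lambda>x. x \<in> generate W K" x "\<lambda>x. len (x \<otimes> w)"] x by blast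
  have [simp]: "x0 \<in> carrier W" using KS x0 by simp
  obtain ms where ms: "reduced ms" "wprod ms = x0 \<otimes> w" using ex_reduced[of "x0 \<otimes> w"] w by auto
  obtain vs where vs: "reduced vs" "set vs \<subseteq> K" "wprod vs = inv x0"
    using generate_reduced[OF KS, of "inv x0"] x0 KS by auto
  have min': "len (wprod ms) \<le> len (y \<otimes> wprod ms)" if "y \<in> generate W K" for y
    using min[of "y \<otimes> x0"] that x0 KS w ms(2) by (simp add: m_assoc generate.eng)
  have red: "reduced (vs @ ms)"
    by (rule reduced_append_minimal[OF KS min' ms(1) vs(1,2)])
  have prod: "wprod (vs @ ms) = w"
    using vs ms w reducedD[OF vs(1)] reducedD[OF ms(1)]
    by (simp add: word_prod_append flip: m_assoc)
  show ?thesis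
  proof (cases vs)
    case Nil
    then show ?thesis using min[OF x] prod ms by simp
  next
    case (Cons s us)
    then have r: "reduced (s # us @ ms)" "s \<otimes> wprod (us @ ms) = w" using red prod by auto
    note r' = reduced_ConsD[OF r(1)]
    have "s \<otimes> w = wprod (us @ ms)"
      using r' r(2) reducedD[OF r'(1)] gen_cancel[of s "wprod (us @ ms)"] by simp
    then have "len (s \<otimes> w) < len w" using r' r(2) by simp
    moreover have "len w < len (s \<otimes> w)"
      using K vs(2) Cons by (auto simp: left_ascents_def)
    ultimately show ?thesis by simp
  qed
qed

lemma len_mult_left:
  assumes w: "w \<in> carrier W" and K: "K \<subseteq> left_ascents W S w" and x: "x \<in> generate W K"
  shows "len (x \<otimes> w) = len x + len w"
proof -
  have KS: "K \<subseteq> S" using K left_ascents_subset by blast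
  obtain ws where ws: "reduced ws" "wprod ws = w" using w ex_reduced by blast
  obtain vs where vs: "reduced vs" "set vs \<subseteq> K" "wprod vs = x"
    using generate_reduced[OF KS x] by blast
  have "reduced (vs @ ws)"
    using reduced_append_minimal[OF KS _ ws(1) vs(1,2)] left_ascents_minimal[OF w K] ws(2) by simp
  moreover have "wprod (vs @ ws) = x \<otimes> w"
    using vs ws reducedD[OF vs(1)] reducedD[OF ws(1)] by (simp add: word_prod_append)
  ultimately show ?thesis using vs ws by (simp add: reduced_def)
qed

lemma len_mult_right:
  assumes w: "w \<in> carrier W" and K: "K \<subseteq> right_ascents W S w" and x: "x \<in> generate W K"
  shows "len (w \<otimes> x) = len w + len x"
proof -
  have KS: "K \<subseteq> S" using K right_ascents_subset by blast
  have xc: "x \<in> carrier W" using KS x by simp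
  have "len (inv x \<otimes> inv w) = len (inv x) + len (inv w)"
    using len_mult_left[of "inv w" K "inv x"] w K x KS ascents_inv[OF w] by simp
  then show ?thesis
    using len_inv[of "w \<otimes> x"] w xc by (simp add: len_inv inv_mult_group)
qed

text \<open>The letters of a reduced word of v are peeled off from the left. Each first letter
  \<open>s\<close> shortens v w = w y, and exchange cannot erase a letter of w because
  \<open>s\<close> is a left ascent. It therefore erases one of y, which gives s w = w t with t in
  W_J.\<close>

lemma kilmoyer:
  assumes w: "w \<in> carrier W" and I: "I \<subseteq> left_ascents W S w" and J: "J \<subseteq> right_ascents W S w"
    and "v \<in> generate W I" "y \<in> generate W J" "v \<otimes> w = w \<otimes> y"
  shows "v \<in> generate W {s \<in> I. inv w \<otimes> s \<otimes> w \<in> J}"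
proof -
  have IS: "I \<subseteq> S" and JS: "J \<subseteq> S"
    using I left_ascents_subset[of w] J right_ascents_subset[of w] by auto
  have "wprod vs \<in> generate W {s \<in> I. inv w \<otimes> s \<otimes> w \<in> J}"
    if "reduced vs" "set vs \<subseteq> I" "y \<in> generate W J" "wprod vs \<otimes> w = w \<otimes> y" for vs y
    using that
  proof (induction vs arbitrary: y)
    case Nil
    then show ?case by (simp add: generate.one)
  next
    case (Cons s vs)
    note red = reduced_ConsD[OF Cons.prems(1)]
    have s: "s \<in> I" "set vs \<subseteq> I" using Cons.prems by auto
    have vsS: "set vs \<subseteq> S" using red reducedD by blast
    have yc [simp]: "y \<in> carrier W" using Cons.prems JS by simp
    obtain ws where ws: "reduced ws" "wprod ws = w" using w ex_reduced by blast
    obtain ys where ys: "reduced ys" "set ys \<subseteq> J" "wprod ys = y"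
      using generate_reduced[OF JS Cons.prems(3)] by blast
    have in_S: "set ws \<subseteq> S" "set ys \<subseteq> S" using ws ys reducedD by auto
    have prod: "wprod (ws @ ys) = w \<otimes> y" using in_S ws ys by (simp add: word_prod_append)
    have swy: "s \<otimes> (w \<otimes> y) = wprod vs \<otimes> w"
      using Cons.prems(4) red(2) vsS w by (simp add: m_assoc flip: Cons.prems(4))
    have "len (wprod (s # vs) \<otimes> w) = len (wprod (s # vs)) + len w"
      using Cons.prems(2) IS by (intro len_mult_left[OF w I] word_prod_in_generate)
    moreover have "len (wprod vs \<otimes> w) = len (wprod vs) + len w"
      using s IS by (intro len_mult_left[OF w I] word_prod_in_generate)
    ultimately have "len (s \<otimes> wprod (ws @ ys)) \<le> len (wprod (ws @ ys))"
      using red(3) Cons.prems(4) swy prod by simp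
    then obtain as b bs where d: "ws @ ys = as @ b # bs"
        and eq: "s \<otimes> wprod (ws @ ys) = wprod (as @ bs)"
      using exchange[of s "ws @ ys"] in_S red(2) by auto
    from d consider us where "ws = as @ b # us" "bs = us @ ys"
      | us where "as = ws @ us" "ys = us @ b # bs"
      by (auto simp: append_eq_append_conv2 append_eq_Cons_conv)
    then show ?case
    proof cases
      case 1
      then have us: "set (as @ us) \<subseteq> S" using in_S by auto
      then have "(s \<otimes> w) \<otimes> y = wprod (as @ us) \<otimes> y"
        using eq in_S red(2) word_prod_append[of "as @ us" ys] ws ys w
        by (simp add: word_prod_append 1(2) m_assoc)
      then have "s \<otimes> w = wprod (as @ us)" using us w red(2) by simp
      then have "len (s \<otimes> w) \<le> length (as @ us)" using len_le us by metis
      then have "len (s \<otimes> w) < len w" using ws 1(1) by (simp add: reduced_def)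
      moreover have "len w < len (s \<otimes> w)"
        using I s(1) by (auto simp: left_ascents_def)
      ultimately show ?thesis by simp
    next
      case 2
      define y' where "y' = wprod (us @ bs)"
      have y': "y' \<in> generate W J"
        unfolding y'_def using ys(2) 2(2) JS by (intro word_prod_in_generate) auto
      then have [simp]: "y' \<in> carrier W" using JS by simp
      have us: "set (us @ bs) \<subseteq> S" using in_S 2 by auto
      have swy': "s \<otimes> (w \<otimes> y) = w \<otimes> y'"
        using eq in_S us word_prod_append[of ws "us @ bs"] prod ws(2) by (simp add: y'_def 2(1))
      define t where "t = y' \<otimes> inv y"
      have t: "t \<in> generate W J" using y' Cons.prems(3) JS by (simp add: t_def generate.eng)
      have tc [simp]: "t \<in> carrier W" using t JS by simp
      have "s \<otimes> w = (s \<otimes> (w \<otimes> y)) \<otimes> inv y" using red(2) w by (simp add: m_assoc)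
      then have sw: "s \<otimes> w = w \<otimes> t" using w by (simp add: swy' t_def m_assoc)
      then have conj: "inv w \<otimes> s \<otimes> w = t"
        using w red(2) by (simp add: m_assoc)
      \<comment> \<open>Additivity of lengths forces t to have length exactly one, so it is a
        generator from \<open>J\<close> and not merely an element of W_J.\<close>
      have "len (s \<otimes> w) = len w + len t" using len_mult_right[OF w J t] sw by simp
      moreover have "len w < len (s \<otimes> w)" using I s(1) by (auto simp: left_ascents_def)
      ultimately have "len t \<noteq> 0" "len t \<le> 1" using len_gen_mult(2)[OF red(2) w] by auto
      then have "t \<in> J" using len_one_gen[OF t JS] len_le[of "[]"] by fastforce
      then have "s \<in> {s \<in> I. inv w \<otimes> s \<otimes> w \<in> J}" using s(1) conj by simp
      moreover have "wprod vs \<in> generate W {s \<in> I. inv w \<otimes> s \<otimes> w \<in> J}"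
        using Cons.IH[OF red(1) s(2) y'] swy swy' by simp
      ultimately show ?thesis by (simp add: generate.eng generate.incl)
    qed
  qed
  moreover obtain vs where "reduced vs" "set vs \<subseteq> I" "wprod vs = v"
    using generate_reduced[OF IS assms(4)] by blast
  ultimately show ?thesis using assms by blast
qed

subsection \<open>Paths in the Coxeter graph\<close>

lemma non_edge_commute:
  assumes "s \<in> S" "t \<in> S" "(s, t) \<notin> coxeter_graph W S"
  shows "s \<otimes> t = t \<otimes> s"
proof (cases "s = t")
  case False
  then have "ord (s \<otimes> t) = 2" using assms by (simp add: coxeter_graph_def)
  then have "(s \<otimes> t) \<otimes> (s \<otimes> t) = \<one>"
    using assms pow_ord_eq_1[of "s \<otimes> t"] by (simp add: numeral_2_eq_2)
  then have "inv (s \<otimes> t) = s \<otimes> t" using assms by (intro inv_equality) simp_all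
  then show ?thesis using assms by (simp add: inv_mult_group)
qed simp

lemma edge_not_commute:
  assumes "(s, t) \<in> coxeter_graph W S"
  shows "s \<otimes> t \<noteq> t \<otimes> s"
proof
  assume eq: "s \<otimes> t = t \<otimes> s"
  have st: "s \<in> S" "t \<in> S" "s \<noteq> t" "ord (s \<otimes> t) \<noteq> 2"
    using assms by (auto simp: coxeter_graph_def)
  have "(s \<otimes> t) \<otimes> (s \<otimes> t) = (s \<otimes> t) \<otimes> (t \<otimes> s)" by (simp only: eq)
  also have "\<dots> = \<one>" using st by (simp add: m_assoc gen_square)
  finally have "ord (s \<otimes> t) dvd 2"
    using st pow_eq_id[of "s \<otimes> t" 2] by (simp add: numeral_2_eq_2)
  \<comment> \<open>Divisibility excludes 0, the code for infinite order, so order 1 is all that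
    remains; it would force s = t.\<close>
  then have "ord (s \<otimes> t) = 1" using st(4) dvd_imp_le[of "ord (s \<otimes> t)" 2]
    by (cases "ord (s \<otimes> t) = 0") auto
  then have "s \<otimes> t = \<one>" using st ord_eq_1 by simp
  then have "inv t = s" using st by (intro inv_equality) simp_all
  then show False using st by simp
qed

text \<open>If z = a s a lay in W_K, then \<open>a\<close> would be a left ascent of z, since
  exchange would otherwise put \<open>a\<close> into W_K. As a z = s a has length at most two, z
  would be a generator; being conjugate to s inside the subgroup of a and z it would equal s, so a
  and s would commute.\<close>

lemma conj_edge_not_in_generate:
  assumes "(a, s) \<in> coxeter_graph W S" "K \<subseteq> S" "a \<notin> K"
  shows "a \<otimes> s \<otimes> a \<notin> generate W K"
proof
  define z where "z = a \<otimes> s \<otimes> a"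
  assume "a \<otimes> s \<otimes> a \<in> generate W K"
  then have z: "z \<in> generate W K" by (simp add: z_def)
  have S: "a \<in> S" "s \<in> S" "a \<noteq> s" using assms(1) by (auto simp: coxeter_graph_def)
  have zc [simp]: "z \<in> carrier W" using S by (simp add: z_def)
  have az: "a \<otimes> z = s \<otimes> a" using S by (simp add: z_def m_assoc)
  obtain zs where zs: "reduced zs" "set zs \<subseteq> K" "wprod zs = z"
    using generate_reduced[OF assms(2) z] by blast
  have "len z < len (a \<otimes> z)"
  proof (rule ccontr)
    assume "\<not> ?thesis"
    then obtain as b bs where d: "zs = as @ b # bs" "a \<otimes> z = wprod (as @ bs)"
      using exchange[of a zs] S zs reducedD[OF zs(1)] by (metis not_less)
    then have "a \<otimes> z \<in> generate W K"
      using zs(2) by (auto intro!: word_prod_in_generate assms)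
    then have "(a \<otimes> z) \<otimes> inv z \<in> generate W K" using z assms(2) by (simp add: generate.eng)
    then have "a \<in> generate W K" using S by (simp add: m_assoc)
    then show False using gen_in_generate S assms by blast
  qed
  moreover have "len (s \<otimes> a) \<le> 2" using len_le[of "[s, a]"] S by simp
  ultimately have "len z \<le> 1" using az by simp
  moreover have "z \<noteq> \<one>"
  proof
    assume "z = \<one>"
    then have "s \<otimes> a = a" using az S by simp
    then have "s = \<one>" using S by simp
    then show False using S gen_ne_one by blast
  qed
  ultimately have "z \<in> K" using len_one_gen[OF z assms(2)] by simp
  then have "z \<in> S" "z \<noteq> a" using assms by auto
  have s_eq: "s = a \<otimes> z \<otimes> a" using S by (simp add: z_def m_assoc gen_square)
  have "a \<otimes> z \<otimes> a \<in> generate W {a, z}" by (intro generate.eng generate.incl) auto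
  then have "s \<in> generate W {a, z}" using s_eq by metis
  then have "s \<in> {a, z}" using gen_in_generate[of s "{a, z}"] S \<open>z \<in> S\<close> by blast
  then have "z = s" using S by simp
  then show False using az edge_not_commute[OF assms(1)] by simp
qed

text \<open>Distinctness keeps each letter outside the subgroup generated by the other letters.
  Non-consecutive letters may be adjacent, so cycles in the graph cause no trouble.\<close>

definition graph_path :: "'a list \<Rightarrow> bool" where
  "graph_path xs \<longleftrightarrow> distinct xs \<and> set xs \<subseteq> S \<and> successively (\<lambda>x y. (x, y) \<in> coxeter_graph W S) xs"

text \<open>A second left descent \<open>b\<close> of the word \<open>as' a b \<dots>\<close> would commute with \<open>as' a\<close>, so that
  \<open>a b a\<close> would be a product of letters other than \<open>a\<close>.\<close>

lemma path_left_descent: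
  assumes "graph_path xs" "t \<in> S" "len (t \<otimes> wprod xs) < len (wprod xs)"
  shows "xs \<noteq> [] \<and> t = hd xs"
proof -
  have xsS: "set xs \<subseteq> S" using assms by (simp add: graph_path_def)
  obtain as b bs where xs: "xs = as @ b # bs" and eq: "t \<otimes> wprod xs = wprod (as @ bs)"
    using exchange[OF assms(2) xsS] assms(3) by auto
  have S: "set as \<subseteq> S" "b \<in> S" "set bs \<subseteq> S" using xs xsS by auto
  have d: "b \<notin> set as" "distinct as" using assms xs by (auto simp: graph_path_def)
  have "(t \<otimes> wprod as \<otimes> b) \<otimes> wprod bs = wprod as \<otimes> wprod bs"
    using eq S assms(2) by (simp add: xs word_prod_append m_assoc)
  then have tab: "t \<otimes> wprod as \<otimes> b = wprod as" using S assms(2) by simp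
  have ta: "t \<otimes> wprod as = wprod as \<otimes> b"
  proof -
    have "t \<otimes> wprod as = (t \<otimes> wprod as \<otimes> b) \<otimes> b"
      using S assms(2) by (simp add: m_assoc gen_square)
    then show ?thesis by (simp only: tab)
  qed
  have "wprod as \<in> generate W (set as)" using S by (intro word_prod_in_generate) auto
  have t_eq: "t = wprod as \<otimes> b \<otimes> inv (wprod as)"
    using S assms(2) by (simp add: m_assoc flip: ta)
  \<comment> \<open>The exchange relation makes \<open>t\<close> the conjugate of \<open>b\<close>
    by the product of \<open>as\<close>. Comparing supports in both directions shows that the erased
    letter is \<open>t\<close> itself.\<close>
  have "t \<in> set as \<or> t = b"
  proof -
    have "wprod as \<otimes> b \<otimes> inv (wprod as) \<in> generate W (insert b (set as))"
      using S by (intro generate.eng generate_inv word_prod_in_generate generate.incl) auto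
    then have "t \<in> generate W (insert b (set as))" using t_eq by simp
    then show ?thesis using gen_in_generate[of t "insert b (set as)"] assms(2) S by blast
  qed
  moreover have "t \<notin> set as"
  proof
    assume "t \<in> set as"
    have "b = inv (wprod as) \<otimes> (t \<otimes> wprod as)"
      unfolding ta using S by (simp flip: m_assoc)
    moreover have "inv (wprod as) \<otimes> (t \<otimes> wprod as) \<in> generate W (set as)"
      using S \<open>t \<in> set as\<close>
      by (intro generate.eng generate_inv word_prod_in_generate generate.incl) auto
    ultimately have "b \<in> generate W (set as)" by metis
    then show False using gen_in_generate S d by blast
  qed
  ultimately have "t = b" by blast
  show ?thesis
  proof (cases as rule: rev_cases)
    case Nil
    then show ?thesis using \<open>t = b\<close> xs by simp
  next
    case (snoc as' a)
    have S': "set as' \<subseteq> S" "a \<in> S" using S snoc by auto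
    have edge: "(a, b) \<in> coxeter_graph W S"
      using assms(1) by (auto simp: graph_path_def xs snoc successively_append_iff)
    have q: "wprod as = wprod as' \<otimes> a" using S' snoc by (simp add: word_prod_append)
    have "b \<otimes> (wprod as' \<otimes> a) \<otimes> a = (wprod as' \<otimes> a) \<otimes> b \<otimes> a"
      using ta \<open>t = b\<close> q by simp
    then have "b \<otimes> wprod as' = wprod as' \<otimes> (a \<otimes> b \<otimes> a)"
      using S S' by (simp add: m_assoc gen_square)
    then have "a \<otimes> b \<otimes> a = inv (wprod as') \<otimes> (b \<otimes> wprod as')"
      using S S' by (simp flip: m_assoc)
    moreover have "inv (wprod as') \<otimes> (b \<otimes> wprod as') \<in> generate W (insert b (set as'))"
      using S S' by (intro generate.eng generate_inv word_prod_in_generate generate.incl) auto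
    ultimately have "a \<otimes> b \<otimes> a \<in> generate W (insert b (set as'))" by metis
    moreover have "a \<notin> insert b (set as')" using d snoc by auto
    ultimately show ?thesis
      using conj_edge_not_in_generate[OF edge, of "insert b (set as')"] S S' by auto
  qed
qed

lemma graph_path_ConsD: "graph_path (d # xs) \<Longrightarrow> graph_path xs"
  by (cases xs) (auto simp: graph_path_def)

lemma graph_path_prefix: "graph_path (us @ vs) \<Longrightarrow> graph_path us"
  by (auto simp: graph_path_def successively_append_iff)

text \<open>The first letter of a reduced word over \<open>K\<close> is a left descent, hence equals
  the first letter of the path. Cancelling it leaves a shorter path whose product is still in
  W_K.\<close>

lemma path_in_generate:
  assumes "graph_path xs" "K \<subseteq> S" "wprod xs \<in> generate W K"
  shows "set xs \<subseteq> K"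
  using assms(1,3)
proof (induction xs)
  case (Cons d xs)
  have S: "d \<in> S" "set xs \<subseteq> S" "d \<notin> set xs" using Cons.prems by (auto simp: graph_path_def)
  obtain zs where zs: "reduced zs" "set zs \<subseteq> K" "wprod zs = wprod (d # xs)"
    using generate_reduced[OF assms(2) Cons.prems(2)] by blast
  have "zs \<noteq> []"
  proof
    assume "zs = []"
    then have "d \<otimes> wprod xs = \<one>" using zs by simp
    then have "inv (wprod xs) = d" using S by (intro inv_equality) simp_all
    then have "d \<in> generate W (set xs)"
      using S generate_inv[of "set xs" "wprod xs"] word_prod_in_generate[of "set xs" xs] by simp
    then show False using gen_in_generate S by blast
  qed
  then obtain u us where u: "zs = u # us" by (cases zs) auto
  have "set us \<subseteq> S" "u \<in> S" using zs u assms(2) by auto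
  then have "u \<otimes> wprod zs = wprod us" using u by simp
  then have "len (u \<otimes> wprod (d # xs)) < len (wprod (d # xs))"
    using reduced_ConsD[of u us] zs u by simp
  then have "u = d" using path_left_descent[OF Cons.prems(1) \<open>u \<in> S\<close>] by simp
  then have "d \<in> K" using zs u by auto
  then have "d \<otimes> wprod (d # xs) \<in> generate W K"
    using generate.eng[OF generate.incl Cons.prems(2)] by blast
  then have "wprod xs \<in> generate W K" using S by simp
  then show ?case using Cons.IH graph_path_ConsD Cons.prems(1) \<open>d \<in> K\<close> by auto
qed simp

lemma path_in_product:
  assumes path: "graph_path xs" "xs \<noteq> []" and I: "I \<subseteq> S" "hd xs \<notin> I" and D: "D \<subseteq> S"
    and "x \<in> generate W I" "z \<in> generate W D" "wprod xs = x \<otimes> z"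
  shows "set xs \<subseteq> D"
proof -
  obtain us0 vs0 where 0: "set us0 \<subseteq> I" "wprod us0 = x" "set vs0 \<subseteq> D" "wprod vs0 = z"
    using assms generate_reduced by metis
  then have "set us0 \<subseteq> S" "set vs0 \<subseteq> S" using I D by auto
  then have "wprod (us0 @ vs0) = wprod xs" "set (us0 @ vs0) \<subseteq> S"
    using assms 0 by (simp_all add: word_prod_append)
  then obtain ys where ys: "reduced ys" "subseq ys (us0 @ vs0)" "wprod ys = wprod xs"
    using reduced_subword by metis
  then obtain us vs where uv: "ys = us @ vs" "subseq us us0" "subseq vs vs0"
    by (auto elim: subseq_appendE)
  then have sub: "set us \<subseteq> I" "set vs \<subseteq> D" using set_subseq 0 by blast+
  show ?thesis
  proof (cases us)
    case Nil
    then have "wprod xs \<in> generate W D"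
      using uv ys sub word_prod_in_generate[OF D sub(2)] by simp
    then show ?thesis using path_in_generate path D by blast
  next
    case (Cons u us')
    then have u: "u \<in> I" "reduced (u # us' @ vs)" "wprod xs = u \<otimes> wprod (us' @ vs)"
      using sub ys uv by auto
    note red = reduced_ConsD[OF u(2)]
    have "u \<otimes> wprod xs = wprod (us' @ vs)"
      using red u(3) reducedD[OF red(1)] by simp
    then have "len (u \<otimes> wprod xs) < len (wprod xs)" using red u by simp
    then have "u = hd xs" using path_left_descent path red by blast
    then show ?thesis using u I by simp
  qed
qed

lemma reachable_path:
  assumes "(d, e) \<in> (Restr (coxeter_graph W S) K)\<^sup>*" "d \<in> K" "K \<subseteq> S"
  obtains xs where "graph_path xs" "xs \<noteq> []" "hd xs = d" "last xs = e" "set xs \<subseteq> K"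
proof -
  let ?P = "\<lambda>e xs. graph_path xs \<and> xs \<noteq> [] \<and> hd xs = d \<and> last xs = e \<and> set xs \<subseteq> K"
  have "\<exists>xs. ?P e xs"
    using assms(1)
  proof (induction rule: rtrancl_induct)
    case base
    have "?P d [d]" using assms by (auto simp: graph_path_def)
    then show ?case by blast
  next
    case (step y z)
    then obtain xs where xs: "?P y xs" by blast
    show ?case
    proof (cases "z \<in> set xs")
      case True
      then obtain us vs where "xs = us @ z # vs" by (meson split_list)
      then have "xs = (us @ [z]) @ vs" by simp
      then have "graph_path (us @ [z])" "hd (us @ [z]) = d" "set (us @ [z]) \<subseteq> K"
        using xs graph_path_prefix by (auto simp: hd_append)
      then have "?P z (us @ [z])" by simp
      then show ?thesis by blast
    next
      case False
      then have "?P z (xs @ [z])"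
        using xs step(2) assms(3) by (auto simp: graph_path_def successively_append_iff)
      then show ?thesis by blast
    qed
  qed
  then show thesis using that by blast
qed

lemma double_coset_iff:
  "z \<in> double_coset W I w J \<longleftrightarrow>
   (\<exists>x\<in>generate W I. \<exists>y\<in>generate W J. z = x \<otimes> w \<otimes> y)"
  by (auto simp: double_coset_def r_coset_def set_mult_def)

lemma double_coset_mono:
  assumes "I \<subseteq> I'" "J \<subseteq> J'"
  shows "double_coset W I w J \<subseteq> double_coset W I' w J'"
  using mono_generate[OF assms(1)] mono_generate[OF assms(2)]
  unfolding subset_iff double_coset_iff by blast

lemma reachable_conjugate:
  assumes w: "w \<in> carrier W" and "I \<subseteq> I'" and I': "I' \<subseteq> left_ascents W S w"
    and J: "J \<subseteq> right_ascents W S w"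
    and cover: "\<And>u. u \<in> generate W I' \<Longrightarrow> u \<otimes> w \<in> double_coset W I w J"
    and d: "d \<in> I' - I" "(d, e) \<in> (Restr (coxeter_graph W S) I')\<^sup>*"
  shows "e \<in> I'" "inv w \<otimes> e \<otimes> w \<in> J"
proof -
  let ?D = "{s \<in> I'. inv w \<otimes> s \<otimes> w \<in> J}"
  have S: "I' \<subseteq> S" "I \<subseteq> S" "J \<subseteq> S"
    using assms(2) I' left_ascents_subset[of w] J right_ascents_subset[of w] by auto
  obtain xs where xs: "graph_path xs" "xs \<noteq> []" "hd xs = d" "last xs = e" "set xs \<subseteq> I'"
    using reachable_path[OF d(2)] d(1) S by blast
  have p: "wprod xs \<in> generate W I'" using xs S by (intro word_prod_in_generate)
  then obtain x y where xy: "x \<in> generate W I" "y \<in> generate W J"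
      "wprod xs \<otimes> w = x \<otimes> w \<otimes> y"
    using cover[OF p] unfolding double_coset_iff by blast
  have c [simp]: "x \<in> carrier W" "y \<in> carrier W" "wprod xs \<in> carrier W" using xy S p by auto
  have "(inv x \<otimes> wprod xs) \<otimes> w = inv x \<otimes> (wprod xs \<otimes> w)" using w by (simp add: m_assoc)
  also have "\<dots> = w \<otimes> y" unfolding xy(3) using w by (simp flip: m_assoc)
  finally have eq: "(inv x \<otimes> wprod xs) \<otimes> w = w \<otimes> y" .
  have "x \<in> generate W I'" using xy(1) assms(2) generate_mono by blast
  then have "inv x \<otimes> wprod xs \<in> generate W I'" using p S by (simp add: generate.eng)
  then have "inv x \<otimes> wprod xs \<in> generate W ?D"
    using kilmoyer[OF w I' J _ xy(2) eq] by simp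
  then have "set xs \<subseteq> ?D"
    using S d(1) xs(3) by (intro path_in_product[OF xs(1,2) S(2) _ _ xy(1)]) auto
  then have "e \<in> ?D" using xs(2,4) last_in_set[of xs] by blast
  then show "e \<in> I'" "inv w \<otimes> e \<otimes> w \<in> J" by auto
qed

subsection \<open>Double cosets and plank moves\<close>

lemma generate_union_commuting:
  assumes "A \<subseteq> S" "B \<subseteq> S" "\<And>a b. a \<in> A \<Longrightarrow> b \<in> B \<Longrightarrow> a \<otimes> b = b \<otimes> a"
    and "x \<in> generate W (A \<union> B)"
  obtains a b where "a \<in> generate W A" "b \<in> generate W B" "x = a \<otimes> b"
proof -
  have swap: "b \<otimes> wprod xs = wprod xs \<otimes> b" if "set xs \<subseteq> A" "b \<in> B" for xs b
    using that
  proof (induction xs)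
    case (Cons a xs)
    have in_S: "a \<in> S" "b \<in> S" "set xs \<subseteq> S" using Cons.prems assms by auto
    have "b \<otimes> wprod (a # xs) = (b \<otimes> a) \<otimes> wprod xs" using in_S by (simp add: m_assoc)
    also have "\<dots> = a \<otimes> (b \<otimes> wprod xs)"
      using in_S assms(3)[of a b, symmetric] Cons.prems by (simp add: m_assoc)
    finally show ?case using Cons in_S by (simp add: m_assoc)
  qed (use assms in auto)
  obtain xs where xs: "set xs \<subseteq> A \<union> B" "wprod xs = x"
    using assms by (auto simp: generate_eq_words)
  have "\<exists>us vs. set us \<subseteq> A \<and> set vs \<subseteq> B \<and> wprod xs = wprod us \<otimes> wprod vs"
    using xs(1)
  proof (induction xs)
    case Nil
    have "wprod [] = wprod [] \<otimes> wprod []" by simp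
    then show ?case by (metis empty_set empty_subsetI)
  next
    case (Cons s xs)
    then obtain us vs where IH: "set us \<subseteq> A" "set vs \<subseteq> B" "wprod xs = wprod us \<otimes> wprod vs"
      by auto
    have in_S: "s \<in> S" "set us \<subseteq> S" "set vs \<subseteq> S" using Cons.prems IH assms by auto
    consider "s \<in> A" | "s \<in> B" using Cons.prems by auto
    then show ?case
    proof cases
      case 1
      then have "wprod (s # xs) = wprod (s # us) \<otimes> wprod vs" "set (s # us) \<subseteq> A"
        using in_S IH by (simp_all add: m_assoc)
      then show ?thesis using IH(2) by blast
    next
      case 2
      have "wprod (s # xs) = (s \<otimes> wprod us) \<otimes> wprod vs"
        using in_S by (simp add: IH(3) m_assoc)
      also have "\<dots> = wprod us \<otimes> wprod (s # vs)"
        using in_S swap[OF IH(1) 2] by (simp add: m_assoc)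
      finally have "wprod (s # xs) = wprod us \<otimes> wprod (s # vs)" .
      moreover have "set (s # vs) \<subseteq> B" using 2 IH by simp
      ultimately show ?thesis using IH(1) by blast
    qed
  qed
  then show thesis
    using that xs(2) word_prod_in_generate assms(1,2) by metis
qed

lemma conj_generate:
  assumes "w \<in> carrier W" "X \<subseteq> S" "J \<subseteq> S" "\<And>x. x \<in> X \<Longrightarrow> inv w \<otimes> x \<otimes> w \<in> J"
    and "b \<in> generate W X"
  shows "inv w \<otimes> b \<otimes> w \<in> generate W J"
proof -
  have "inv w \<otimes> wprod xs \<otimes> w \<in> generate W J" if "set xs \<subseteq> X" for xs
    using that
  proof (induction xs)
    case Nil
    then show ?case using assms(1) by (simp add: generate.one)
  next
    case (Cons x xs)
    have in_S: "x \<in> S" "set xs \<subseteq> S" using Cons.prems assms(2) by auto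
    have "inv w \<otimes> (x \<otimes> wprod xs) \<otimes> w = (inv w \<otimes> x \<otimes> w) \<otimes> (inv w \<otimes> wprod xs \<otimes> w)"
      using assms(1) in_S by (simp add: m_assoc)
    moreover have "inv w \<otimes> x \<otimes> w \<in> generate W J" "inv w \<otimes> wprod xs \<otimes> w \<in> generate W J"
      using Cons assms(4) by (auto intro: generate.incl)
    ultimately show ?case by (simp add: generate.eng)
  qed
  then show ?thesis using assms(2,5) by (auto simp: generate_eq_words)
qed

lemma contract_left_double_coset:
  assumes w: "w \<in> carrier W" and "I \<subseteq> S" "J \<subseteq> S" "X \<subseteq> I"
    and closed: "\<And>x y. x \<in> X \<Longrightarrow> y \<in> I \<Longrightarrow> (x, y) \<in> coxeter_graph W S \<Longrightarrow> y \<in> X"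
    and conj: "\<And>x. x \<in> X \<Longrightarrow> inv w \<otimes> x \<otimes> w \<in> J"
  shows "double_coset W (I - X) w J = double_coset W I w J"
proof
  show "double_coset W (I - X) w J \<subseteq> double_coset W I w J"
    by (intro double_coset_mono) auto
  show "double_coset W I w J \<subseteq> double_coset W (I - X) w J"
  proof
    fix z assume "z \<in> double_coset W I w J"
    then obtain x y where xy: "x \<in> generate W I" "y \<in> generate W J" "z = x \<otimes> w \<otimes> y"
      unfolding double_coset_iff by blast
    have X: "X \<subseteq> S" "I - X \<subseteq> S" using assms by auto
    have comm: "a \<otimes> b = b \<otimes> a" if "a \<in> I - X" "b \<in> X" for a b
      using that non_edge_commute[of b a] closed[of b a] X by (metis Diff_iff subsetD)
    have "(I - X) \<union> X = I" using assms(4) by blast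
    then obtain a b where ab: "a \<in> generate W (I - X)" "b \<in> generate W X" "x = a \<otimes> b"
      using generate_union_commuting[OF X(2,1) comm] xy(1) by metis
    have [simp]: "a \<in> carrier W" "b \<in> carrier W" "y \<in> carrier W"
      using X ab xy assms(3) by simp_all
    have "z = a \<otimes> w \<otimes> ((inv w \<otimes> b \<otimes> w) \<otimes> y)"
      using w by (simp add: xy ab m_assoc)
    moreover have "(inv w \<otimes> b \<otimes> w) \<otimes> y \<in> generate W J"
      using conj_generate[OF w X(1) assms(3) conj ab(2)] xy(2) by (rule generate.eng)
    ultimately show "z \<in> double_coset W (I - X) w J"
      using ab(1) unfolding double_coset_iff by blast
  qed
qed

lemma double_coset_inv:
  assumes w: "w \<in> carrier W" and "I \<subseteq> S" "J \<subseteq> S"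
  shows "z \<in> double_coset W J (inv w) I \<longleftrightarrow> z \<in> carrier W \<and> inv z \<in> double_coset W I w J"
proof -
  have *: "inv (x \<otimes> v \<otimes> y) \<in> double_coset W B (inv v) A"
    if "v \<in> carrier W" "A \<subseteq> S" "B \<subseteq> S" "x \<in> generate W A" "y \<in> generate W B" for x y v A B
  proof -
    have "inv (x \<otimes> v \<otimes> y) = inv y \<otimes> inv v \<otimes> inv x"
      using that by (simp add: inv_mult_group m_assoc)
    then show ?thesis using that unfolding double_coset_iff by fastforce
  qed
  show ?thesis
  proof
    assume "z \<in> double_coset W J (inv w) I"
    then obtain y x where "y \<in> generate W J" "x \<in> generate W I" "z = y \<otimes> inv w \<otimes> x"
      unfolding double_coset_iff by blast
    then show "z \<in> carrier W \<and> inv z \<in> double_coset W I w J"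
      using *[of "inv w" J I y x] assms by simp
  next
    assume "z \<in> carrier W \<and> inv z \<in> double_coset W I w J"
    then obtain y x where "y \<in> generate W J" "x \<in> generate W I" "inv z = x \<otimes> w \<otimes> y"
        "z \<in> carrier W"
      unfolding double_coset_iff by blast
    then show "z \<in> double_coset W J (inv w) I"
      using *[of w I J x y] assms by (metis inv_inv)
  qed
qed

lemma double_coset_inv_eq:
  assumes "w \<in> carrier W" "I \<subseteq> S" "J \<subseteq> S" "I' \<subseteq> S" "J' \<subseteq> S"
    and "double_coset W J (inv w) I = double_coset W J' (inv w) I'"
  shows "double_coset W I w J = double_coset W I' w J'"
  using double_coset_inv[of "inv w" J I] double_coset_inv[of "inv w" J' I'] assms by auto

lemma ascent_rows_inv:
  assumes "w \<in> carrier W"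
  shows "small_left_ascents W S (inv w) = small_right_ascents W S w"
    and "small_right_ascents W S (inv w) = small_left_ascents W S w"
    and "top_row_graph W S (inv w) = bottom_row_graph W S w"
    and "bottom_row_graph W S (inv w) = top_row_graph W S w"
proof -
  show 1: "small_left_ascents W S (inv w) = small_right_ascents W S w"
    "small_right_ascents W S (inv w) = small_left_ascents W S w"
    using assms by (auto simp: small_left_ascents_def small_right_ascents_def ascents_inv)
  show "top_row_graph W S (inv w) = bottom_row_graph W S w"
    "bottom_row_graph W S (inv w) = top_row_graph W S w"
    using assms by (auto simp: top_row_graph_def bottom_row_graph_def ascents_inv 1)
qed

lemma plank_move_inv:
  assumes w: "w \<in> carrier W" and "plank_move W S w (I, J) (I', J')"
  shows "plank_move W S (inv w) (J, I) (J', I')"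
proof -
  note inv_simps = ascents_inv[OF w] ascent_rows_inv[OF w] inv_inv[OF w]
  note moves = plank_move.intros[of _ W S "inv w", unfolded inv_simps]
  show ?thesis
    using assms(2)
  proof cases
    case (contract_left I0 J0)
    then show ?thesis using moves(4)[of J I I0 J0] by simp
  next
    case (expand_left I0 J0)
    then show ?thesis using moves(5)[of J I' I0 J0] by simp
  next
    case (slide_left I0 J0)
    then show ?thesis using moves(6)[of J I I0 J0] by simp
  next
    case (contract_right J0 I0)
    then show ?thesis using moves(1)[of J I J0 I0] by simp
  next
    case (expand_right J0 I0)
    then show ?thesis using moves(2)[of J' I J0 I0] by simp
  next
    case (slide_right J0 I0)
    then show ?thesis using moves(3)[of J I J0 I0] by simp
  qed
qed

lemma componentsD:
  assumes "C \<in> components E A"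
  shows "C \<subseteq> A" and "x \<in> C \<Longrightarrow> y \<in> A \<Longrightarrow> (x, y) \<in> E \<Longrightarrow> y \<in> C"
proof -
  obtain a where a: "a \<in> A" "C = (Restr E A)\<^sup>* `` {a}"
    using assms by (auto simp: components_def elim: quotientE)
  have "x \<in> A" if "(a, x) \<in> (Restr E A)\<^sup>*" for x
    using that a(1) by (induction rule: rtrancl_induct) auto
  then show "C \<subseteq> A" using a(2) by blast
  show "y \<in> C" if "x \<in> C" "y \<in> A" "(x, y) \<in> E"
  proof -
    have "(x, y) \<in> Restr E A" using that \<open>C \<subseteq> A\<close> by blast
    then show ?thesis using that(1) a(2) by (auto intro: rtrancl_into_rtrancl)
  qed
qed

lemma conj_set: "x <#\<^bsub>W\<^esub> K #>\<^bsub>W\<^esub> y = (\<lambda>s. x \<otimes> s \<otimes> y) ` K"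
  by (auto simp: l_coset_def r_coset_def)

lemma contract_component_double_coset:
  assumes w: "w \<in> carrier W" and "I \<subseteq> S" "J \<subseteq> S"
    and "I0 \<in> components (coxeter_graph W S) I" "inv w <#\<^bsub>W\<^esub> I0 #>\<^bsub>W\<^esub> w \<subseteq> J"
  shows "double_coset W (I - I0) w J = double_coset W I w J"
  using assms componentsD[OF assms(4)]
  by (intro contract_left_double_coset) (auto simp: conj_set)

lemma conj_small_left_ascent:
  assumes w: "w \<in> carrier W" and s: "s \<in> small_left_ascents W S w"
  shows "inv w \<otimes> s \<otimes> w \<in> small_right_ascents W S w"
proof -
  have "s \<in> S" using s left_ascents_subset by (auto simp: small_left_ascents_def)
  then have "w \<otimes> (inv w \<otimes> s \<otimes> w) = s \<otimes> w" using w by (simp add: m_assoc)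
  moreover from this have "w \<otimes> (inv w \<otimes> s \<otimes> w) \<otimes> inv w = s"
    using w \<open>s \<in> S\<close> by (simp add: m_assoc)
  ultimately show ?thesis
    using s \<open>s \<in> S\<close>
    by (simp add: small_left_ascents_def small_right_ascents_def left_ascents_def
        right_ascents_def)
qed

lemma slide_double_coset:
  assumes w: "w \<in> carrier W" and I: "I \<subseteq> left_ascents W S w" and J: "J \<subseteq> right_ascents W S w"
    and I0: "I0 \<in> components (coxeter_graph W S) I" "I0 \<subseteq> small_left_ascents W S w"
    and J0: "J0 = inv w <#\<^bsub>W\<^esub> I0 #>\<^bsub>W\<^esub> w" "J \<inter> J0 = {}"
      "J0 \<in> components (top_row_graph W S w) (J \<union> J0)"
  shows "double_coset W (I - I0) w (J \<union> J0) = double_coset W I w J"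
proof -
  have small: "J0 \<subseteq> small_right_ascents W S w"
    using I0(2) conj_small_left_ascent[OF w] by (auto simp: J0(1) conj_set)
  then have asc: "J \<union> J0 \<subseteq> right_ascents W S w"
    using J by (auto simp: small_right_ascents_def)
  have S: "I \<subseteq> S" "J \<subseteq> S" "J \<union> J0 \<subseteq> S" "J0 \<subseteq> J \<union> J0"
    using I J asc left_ascents_subset right_ascents_subset by blast+
  have closed: "y \<in> J0" if "x \<in> J0" "y \<in> J \<union> J0" "(x, y) \<in> coxeter_graph W S" for x y
  proof -
    have "(x, y) \<in> top_row_graph W S w"
      using that small asc by (auto simp: top_row_graph_def)
    then show ?thesis using componentsD(2)[OF J0(3) that(1,2)] by blast
  qed
  have conj: "inv (inv w) \<otimes> x \<otimes> inv w \<in> I" if x: "x \<in> J0" for x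
  proof -
    obtain s where s: "s \<in> I0" "x = inv w \<otimes> s \<otimes> w" using x by (auto simp: J0(1) conj_set)
    then have "s \<in> I" using componentsD(1)[OF I0(1)] by blast
    then show ?thesis using s w S(1) by (auto simp: m_assoc)
  qed
  have "double_coset W (J \<union> J0 - J0) (inv w) I = double_coset W (J \<union> J0) (inv w) I"
    using w S(1,3,4) closed conj by (intro contract_left_double_coset) auto
  moreover have "J \<union> J0 - J0 = J" using J0(2) by blast
  ultimately have "double_coset W I w J = double_coset W I w (J \<union> J0)"
    using double_coset_inv_eq[of w I J I "J \<union> J0"] w S by simp
  then show ?thesis
    using contract_component_double_coset[OF w S(1,3) I0(1)] J0(1) by simp
qed

lemma plank_move_double_coset:
  assumes w: "w \<in> carrier W" and "plank_move W S w (I, J) (I', J')"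
  shows "double_coset W I' w J' = double_coset W I w J"
proof -
  note inv_simps = ascents_inv[OF w] ascent_rows_inv[OF w] inv_inv[OF w]
  have S: "K \<subseteq> S" if "K \<subseteq> left_ascents W S w \<or> K \<subseteq> right_ascents W S w" for K
    using that left_ascents_subset[of w] right_ascents_subset[of w] by blast
  have contract_J: "double_coset W A w (B - B0) = double_coset W A w B"
    if "A \<subseteq> left_ascents W S w" "B \<subseteq> right_ascents W S w"
      "B0 \<in> components (coxeter_graph W S) B" "w <#\<^bsub>W\<^esub> B0 #>\<^bsub>W\<^esub> inv w \<subseteq> A" for A B B0
  proof -
    have "double_coset W (B - B0) (inv w) A = double_coset W B (inv w) A"
      using that w S contract_component_double_coset[of "inv w" B A B0] by simp
    moreover have "A \<subseteq> S" "B \<subseteq> S" "B - B0 \<subseteq> S" using that S by blast+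
    ultimately show ?thesis using double_coset_inv_eq[OF w] by blast
  qed
  show ?thesis
    using assms(2)
  proof cases
    case (contract_left I0 J0)
    then show ?thesis using contract_component_double_coset[OF w, of I J I0] S by simp
  next
    case (expand_left I0 J0)
    then show ?thesis using contract_component_double_coset[OF w, of I' J I0] S by simp
  next
    case (slide_left I0 J0)
    then show ?thesis using slide_double_coset[OF w, of I J I0 J0] by simp
  next
    case (contract_right J0 I0)
    then show ?thesis using contract_J[of I J J0] by simp
  next
    case (expand_right J0 I0)
    then show ?thesis using contract_J[of I J' J0] by simp
  next
    case (slide_right J0 I0)
    have "double_coset W (J - J0) (inv w) (I \<union> I0) = double_coset W J (inv w) I"
      using slide_double_coset[of "inv w" J I J0 I0] w slide_right by (simp add: inv_simps)
    moreover have "I0 \<subseteq> small_left_ascents W S w"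
      using slide_right conj_small_left_ascent[of "inv w"] w by (auto simp: conj_set inv_simps)
    then have "I \<union> I0 \<subseteq> S" "I \<subseteq> S" "J \<subseteq> S" "J - J0 \<subseteq> S"
      using slide_right S[of I] S[of J] left_ascents_subset[of w]
      by (auto simp: small_left_ascents_def)
    ultimately show ?thesis using double_coset_inv_eq[OF w] slide_right by metis
  qed
qed

definition linked :: "'a \<Rightarrow> 'a set \<times> 'a set \<Rightarrow> 'a set \<times> 'a set \<Rightarrow> bool" where
  "linked w P Q \<longleftrightarrow> (plank_move W S w)\<^sup>*\<^sup>* P Q \<and> (plank_move W S w)\<^sup>*\<^sup>* Q P"

lemma linked_refl: "linked w P P"
  by (simp add: linked_def)

lemma linked_sym: "linked w P Q \<Longrightarrow> linked w Q P"
  by (simp add: linked_def)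

lemma linked_trans: "linked w P Q \<Longrightarrow> linked w Q R \<Longrightarrow> linked w P R"
  unfolding linked_def by (meson rtranclp_trans)

lemma linked_inv:
  assumes "w \<in> carrier W" "linked w (I, J) (I', J')"
  shows "linked (inv w) (J, I) (J', I')"
proof -
  have "(plank_move W S (inv w))\<^sup>*\<^sup>* (prod.swap P) (prod.swap Q)"
    if "(plank_move W S w)\<^sup>*\<^sup>* P Q" for P Q
    using that
  proof (induction rule: rtranclp_induct)
    case (step Q R)
    then have "plank_move W S (inv w) (prod.swap Q) (prod.swap R)"
      using plank_move_inv[OF assms(1)] by (cases Q; cases R) simp
    then show ?case using step by simp
  qed simp
  from this[of "(I, J)" "(I', J')"] this[of "(I', J')" "(I, J)"] show ?thesis
    using assms(2) by (simp add: linked_def)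
qed

lemma linked_remove:
  assumes w: "w \<in> carrier W" and "finite I" "I \<subseteq> left_ascents W S w" "J \<subseteq> right_ascents W S w"
    and "X \<subseteq> I" "\<And>x. x \<in> X \<Longrightarrow> inv w \<otimes> x \<otimes> w \<in> J"
    and "\<And>x y. x \<in> X \<Longrightarrow> y \<in> I \<Longrightarrow> (x, y) \<in> coxeter_graph W S \<Longrightarrow> y \<in> X"
  shows "linked w (I, J) (I - X, J)"
  using assms(2-)
proof (induction "card X" arbitrary: I X rule: less_induct)
  case less
  show ?case
  proof (cases "X = {}")
    case True
    then show ?thesis by (simp add: linked_refl)
  next
    case False
    then obtain x where x: "x \<in> X" by blast
    define C where "C = (Restr (coxeter_graph W S) I)\<^sup>* `` {x}"
    have C: "C \<in> components (coxeter_graph W S) I"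
      using x less.prems(4) by (auto simp: C_def components_def intro: quotientI)
    have "y \<in> X" if "(x, y) \<in> (Restr (coxeter_graph W S) I)\<^sup>*" for y
      using that x less.prems(6) by (induction rule: rtrancl_induct) auto
    then have CX: "C \<subseteq> X" "x \<in> C" by (auto simp: C_def)
    have small: "C \<subseteq> small_left_ascents W S w"
      using CX less.prems(2,3,4,5) right_ascents_subset[of w]
      by (fastforce simp: small_left_ascents_def)
    have sub: "inv w <#\<^bsub>W\<^esub> C #>\<^bsub>W\<^esub> w \<subseteq> J" using CX less.prems(5) by (auto simp: conj_set)
    have "linked w (I, J) (I - C, J)"
      using contract_left[OF less.prems(2,3) C small refl sub]
        expand_left[OF less.prems(2,3) C small refl sub]
      by (simp add: linked_def r_into_rtranclp)
    moreover have "linked w (I - C, J) (I - C - (X - C), J)"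
    proof (rule less.hyps)
      have "finite X" using less.prems finite_subset by blast
      then show "card (X - C) < card X" using x CX by (intro psubset_card_mono) auto
      show "y \<in> X - C" if "z \<in> X - C" "y \<in> I - C" "(z, y) \<in> coxeter_graph W S" for z y
        using that less.prems(6) by blast
    qed (use less.prems in auto)
    moreover have "I - C - (X - C) = I - X" using CX by blast
    ultimately show ?thesis using linked_trans by metis
  qed
qed

lemma linked_expand:
  assumes w: "w \<in> carrier W" and "finite I'" "I \<subseteq> I'" and I': "I' \<subseteq> left_ascents W S w"
    and J: "J \<subseteq> right_ascents W S w"
    and cover: "\<And>u. u \<in> generate W I' \<Longrightarrow> u \<otimes> w \<in> double_coset W I w J"
  shows "linked w (I, J) (I', J)"
proof -
  define X where "X = (Restr (coxeter_graph W S) I')\<^sup>* `` (I' - I)"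
  have X: "x \<in> I'" "inv w \<otimes> x \<otimes> w \<in> J" if "x \<in> X" for x
    using that reachable_conjugate[OF w assms(3) I' J cover] unfolding X_def by blast+
  have closed: "y \<in> X" if "x \<in> X" "y \<in> I'" "(x, y) \<in> coxeter_graph W S" for x y
    using that X(1)[OF that(1)] unfolding X_def by (auto intro: rtrancl_into_rtrancl)
  have "linked w (I', J) (I' - X, J)"
    using X(1) by (intro linked_remove[OF w assms(2) I' J _ X(2) closed]) blast+
  moreover have "linked w (I, J) (I - X \<inter> I, J)"
  proof (rule linked_remove[OF w _ _ J])
    show "finite I" "I \<subseteq> left_ascents W S w"
      using assms(2,3) I' finite_subset by blast+
    show "y \<in> X \<inter> I" if "x \<in> X \<inter> I" "y \<in> I" "(x, y) \<in> coxeter_graph W S" for x y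
      using that closed[of x y] assms(3) by blast
  qed (use X(2) in blast)+
  moreover have "I - X \<inter> I = I' - X" using assms(3) by (auto simp: X_def)
  ultimately show ?thesis using linked_sym linked_trans by metis
qed

lemma double_coset_union:
  assumes w: "w \<in> carrier W" and S: "I \<subseteq> S" "J \<subseteq> S" "I' \<subseteq> S" "J' \<subseteq> S"
    and eq: "double_coset W I w J = double_coset W I' w J'"
  shows "double_coset W (I \<union> I') w (J \<union> J') = double_coset W I w J"
proof
  let ?C = "double_coset W I w J"
  have cosetI: "x \<otimes> w \<otimes> y \<in> double_coset W A w B" if "x \<in> generate W A" "y \<in> generate W B" for x y A B
    using that unfolding double_coset_iff by blast
  have closed: "c \<in> carrier W" if "c \<in> ?C" for c
    using that w S by (auto simp: double_coset_iff)
  have left: "s \<otimes> c \<in> double_coset W A w B"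
    if AB: "A \<subseteq> S" "B \<subseteq> S" "s \<in> A" "c \<in> double_coset W A w B" for s c A B
  proof -
    obtain x y where xy: "x \<in> generate W A" "y \<in> generate W B" "c = x \<otimes> w \<otimes> y"
      using AB(4) unfolding double_coset_iff by blast
    then have "s \<otimes> c = (s \<otimes> x) \<otimes> w \<otimes> y" using AB w by (auto simp: m_assoc subset_iff)
    then show ?thesis 
      using cosetI[OF generate.eng[OF generate.incl[OF AB(3)] xy(1)] xy(2)] by simp
  qed
  have right: "c \<otimes> s \<in> double_coset W A w B"
    if AB: "A \<subseteq> S" "B \<subseteq> S" "s \<in> B" "c \<in> double_coset W A w B" for s c A B
  proof -
    obtain x y where xy: "x \<in> generate W A" "y \<in> generate W B" "c = x \<otimes> w \<otimes> y"
      using AB(4) unfolding double_coset_iff by blast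
    then have "c \<otimes> s = x \<otimes> w \<otimes> (y \<otimes> s)" using AB w by (auto simp: m_assoc subset_iff)
    then show ?thesis 
      using cosetI[OF xy(1) generate.eng[OF xy(2) generate.incl[OF AB(3)]]] by simp
  qed
  have left_words: "wprod us \<otimes> c \<in> ?C" if "set us \<subseteq> I \<union> I'" "c \<in> ?C" for us c
    using that(1)
  proof (induction us)
    case Nil
    then show ?case using that(2) closed by simp
  next
    case (Cons u us)
    then have "u \<in> S" "set us \<subseteq> S" "wprod us \<otimes> c \<in> ?C" using S by auto
    moreover from this have "u \<otimes> (wprod us \<otimes> c) \<in> ?C"
      using left[of I J u] left[of I' J' u] S eq Cons.prems by auto
    ultimately show ?case using closed[OF that(2)] by (simp add: m_assoc)
  qed
  have right_words: "c \<otimes> wprod us \<in> ?C" if "set us \<subseteq> J \<union> J'" "c \<in> ?C" for us c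
    using that
  proof (induction us arbitrary: c)
    case Nil
    then show ?case using closed by simp
  next
    case (Cons u us)
    then have "u \<in> S" "set us \<subseteq> S" "c \<in> carrier W" using S closed by auto
    moreover have "c \<otimes> u \<in> ?C"
      using right[of I J u] right[of I' J' u] S eq Cons.prems by auto
    then have "(c \<otimes> u) \<otimes> wprod us \<in> ?C" using Cons by simp
    ultimately show ?case by (simp add: m_assoc)
  qed
  have "w \<in> ?C" using cosetI[OF generate.one generate.one, of I J] w by simp
  show "double_coset W (I \<union> I') w (J \<union> J') \<subseteq> ?C"
  proof
    fix z assume "z \<in> double_coset W (I \<union> I') w (J \<union> J')"
    then obtain us vs where "set us \<subseteq> I \<union> I'" "set vs \<subseteq> J \<union> J'" "z = wprod us \<otimes> w \<otimes> wprod vs"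
      using S by (auto simp: double_coset_iff generate_eq_words)
    then show "z \<in> ?C" using left_words right_words \<open>w \<in> ?C\<close> by blast
  qed
  show "?C \<subseteq> double_coset W (I \<union> I') w (J \<union> J')"
    by (intro double_coset_mono) auto
qed

lemma linked_union:
  assumes "finite S" and w: "w \<in> carrier W"
    and I: "I \<subseteq> left_ascents W S w" "I' \<subseteq> left_ascents W S w"
    and J: "J \<subseteq> right_ascents W S w" "J' \<subseteq> right_ascents W S w"
    and eq: "double_coset W I w J = double_coset W I' w J'"
  shows "linked w (I, J) (I \<union> I', J \<union> J')"
proof -
  let ?A = "I \<union> I'" and ?B = "J \<union> J'"
  have asc: "?A \<subseteq> left_ascents W S w" "?B \<subseteq> right_ascents W S w" using I J by auto
  have S: "I \<subseteq> S" "I' \<subseteq> S" "J \<subseteq> S" "J' \<subseteq> S" "?A \<subseteq> S" "?B \<subseteq> S"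
    using I J left_ascents_subset[of w] right_ascents_subset[of w] by auto
  then have fin: "finite ?A" "finite ?B" using assms(1) finite_subset by blast+
  have union: "double_coset W ?A w ?B = double_coset W I w J"
    by (rule double_coset_union[OF w]) (use S eq in auto)
  have "linked w (I, J) (?A, J)"
  proof (rule linked_expand[OF w fin(1) _ asc(1) J(1)])
    fix u assume u: "u \<in> generate W ?A"
    then have "u \<in> carrier W" using generate_closed[OF S(5)] by simp
    then have "u \<otimes> w = u \<otimes> w \<otimes> \<one>" using w by simp
    then show "u \<otimes> w \<in> double_coset W I w J"
      using u generate.one unfolding union[symmetric] double_coset_iff by blast
  qed simp
  moreover have "linked (inv w) (J, ?A) (?B, ?A)"
  proof (rule linked_expand[OF _ fin(2)])
    fix u assume u: "u \<in> generate W ?B"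
    then have uc: "u \<in> carrier W" using generate_closed[OF S(6)] by simp
    have "inv (u \<otimes> inv w) = \<one> \<otimes> w \<otimes> inv u" using uc w by (simp add: inv_mult_group)
    then have "inv (u \<otimes> inv w) \<in> double_coset W ?A w ?B"
      using u generate.one generate_inv[OF S(6) u] unfolding double_coset_iff by blast
    then have "inv (u \<otimes> inv w) \<in> double_coset W ?A w J"
      unfolding union using double_coset_mono[of I ?A J J] by blast
    then show "u \<otimes> inv w \<in> double_coset W J (inv w) ?A"
      using double_coset_inv[OF w S(5,3)] uc w by simp
  qed (use w asc ascents_inv[OF w] in auto)
  then have "linked w (?A, J) (?A, ?B)" using linked_inv[of "inv w"] w by simp
  ultimately show ?thesis by (rule linked_trans)
qed

end

theorem theorem4p14:
  fixes W :: "('a, 'b) monoid_scheme" and S I J I' J' :: "'a set" and w :: 'a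
  assumes "coxeter_system W S"
    and "finite S"
    and "w \<in> carrier W"
    and "I \<subseteq> left_ascents W S w" and "J \<subseteq> right_ascents W S w"
    and "I' \<subseteq> left_ascents W S w" and "J' \<subseteq> right_ascents W S w"
  shows "double_coset W I w J = double_coset W I' w J' \<longleftrightarrow>
    (plank_move W S w)\<^sup>*\<^sup>* (I', J') (I, J)"
proof
  interpret coxeter_system W S by (rule assms(1))
  assume eq: "double_coset W I w J = double_coset W I' w J'"
  have "linked w (I, J) (I \<union> I', J \<union> J')" "linked w (I', J') (I' \<union> I, J' \<union> J)"
    using linked_union[OF assms(2,3)] assms(4-7) eq by simp_all
  then have "linked w (I', J') (I, J)"
    using linked_sym linked_trans by (metis Un_commute)
  then show "(plank_move W S w)\<^sup>*\<^sup>* (I', J') (I, J)" by (simp add: linked_def)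
next
  interpret coxeter_system W S by (rule assms(1))
  assume "(plank_move W S w)\<^sup>*\<^sup>* (I', J') (I, J)"
  then show "double_coset W I w J = double_coset W I' w J'"
    by (induction rule: rtranclp_induct2) (use plank_move_double_coset[OF assms(3)] in auto)
qed

end
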